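(* Let $\Omega_{\mathbf u}\subset\mathbb C^n$ have $d\ge 2$ elements, let $s_1\in\Omega_{\mathbf u}$, let $\sigma_0,\sigma_1\in\mathfrak S_{\Omega_{\mathbf u}}$ be permutations given by evaluation oracles and generating a transitive group on $\Omega_{\mathbf u}$, and let $\alpha\ge1$ be an integer. Run the algorithm MonodromySolve – Monodromy Coordinates (described in the context) on this input. Then: 1. The algorithm correctly evaluates any optional accumulator $\mathcal G=\sum_{s\in\Omega_{\mathbf u}}g(s)$. 2. It performs no more than $d-1+j^*\cdot(\min(\max(M),\alpha)+1)$ oracle queries. 3. Its memory cost is approximately that of a monodromy tree of type V: beyond the storage of $\sigma$ and of the accumulator, it stores at most $\left(\sum_{i=1}^r\lceil m_i/\alpha\rceil\right)$ points of $\mathbb C^n$ and $2r-1$ integers, plus a bounded number of further points and integers. 4. In expectation, for $\sigma_0,\sigma_1$ independent and uniformly random in $\mathfrak S_{\Omega_{\mathbf u}}\cong\mathfrak S_d$ (conditioned on generating a transitive group), the space complexity in bits is $\mathcal O(\max(n(d/\alpha),\,n\ln d))$ and the time complexity in oracle queries is $\mathcal O(d\min(\lambda d,\alpha))$, where $\lambda\approx0.6243$ is the Golomb–Dickman constant.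
   Context: Setting. $\Omega_{\mathbf u}$ is the solution set of a polynomial system $F(\mathbf x;\mathbf u)=0$ at a regular parameter value $\mathbf u$ (a fibre of a degree-$d$ branched cover $X\to Y$, where $X=\{F(\mathbf x;\mathbf p)=0\}\subseteq\mathbb C^n\times\mathbb C^k$ is irreducible and $Y$ is the closure of its projection to $\mathbb C^k$). "Strong monodromy assumptions": the monodromy group is all of $\mathfrak S_{\Omega_{\mathbf u}}\cong\mathfrak S_d$; its elements can be sampled uniformly at random; and an evaluation oracle returns $\sigma_i(s)$ for given $\sigma_i$ and $s$, each evaluation counting as one query. $\sigma$ denotes the pair of oracles. $g$ is any function on $\Omega_{\mathbf u}$ with values in a vector space (or abelian group). Algorithm MonodromySolve (used only to define notation). $S$ is an ordered list, and a point is "new" if it is not in $S$. Start with $S=(s_1)$, $j=1$; write $s_i$ for the $i$-th element of $S$. While $|S|<d$: let $q:=\sigma_0(\mathrm{last}(S))$. If $q$ is new, append it to $S$. Otherwise let $q:=\sigma_1(s_j)$; as long as $q$ is not new, replace $j$ by $j+1$ and recompute $q:=\sigma_1(s_j)$; once $q$ is new, call the current $j$ a founder index, append $q$ to $S$, and replace $j$ by $j+1$. The resulting order $s_1,\dots,s_d$ is the monodromy ordering. Notation. $r$ is the number of cycles of $\sigma_0$ (including fixed points); $\mathcal C=(c_1,\dots,c_r)$ are the minimal elements of these cycles in the monodromy ordering; $(m_1,\dots,m_r)$ are the corresponding cycle lengths, and in the claim $M=(m_1,\dots,m_r)$, so $\max(M)$ is the largest cycle length of $\sigma_0$. $j^*$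 is the largest founder index ($j^*=0$ if there are none). $\mathcal C_\alpha$ consists of $c_i,\sigma_0^\alpha(c_i),\sigma_0^{2\alpha}(c_i),\dots$ ($\lceil m_i/\alpha\rceil$ points) for each cycle $i$. A monodromy tree of type V is the data $(\mathcal C_\alpha,\sigma,\mathcal F,(m_1,\dots,m_r))$, with $\mathcal F$ the list of the $r-1$ founder indices. Subroutine next$(\mathcal I,\sigma,M,j,sj)$, where $sj$ stores $s_j$: if $j=\sum_{i=1}^{k-1}M_i$ for some $k\ge2$, return the $k$-th element of $\mathcal I$ (no query); otherwise return $\sigma_0(sj)$ (one query). Subroutine inNewCycle$(\mathcal K,\sigma,M,s)$, where $\mathcal K$ is a set of stored points: if $s\in\mathcal K$, return false. Then repeat $\min(\max(M),\alpha)-1$ times: replace $s$ by $\sigma_0(s)$; if $s\in\mathcal K$, return false. If the loop ends, return true. (Here $M$ is the current list of completed cycle sizes; the copy of $s$ is local.) Algorithm MonodromySolve – Monodromy Coordinates. Lists: $\mathcal I$ (initial cycle solutions), $\mathcal J$ (additional stored solutions), $M$ (cycle sizes), $\mathcal F$ (founder indices). (1) Initialize $\mathcal I=(s_1)$, $\mathcal J=()$, $M=()$, $\mathcal F=()$, $m=1$, $j=1$, $sj=s_1$, $s=s_1$, $a=0$, $\mathcal G=g(s_1)$. (2) While the stopping criterion (all $d$ solutions have been found) is not met: (2a) Replace $s$ by $\sigma_0(s)$. (2b) If $s\ne\mathrm{last}(\mathcal I)$: increase $m$ and $a$ by $1$; add $g(s)$ to $\mathcal G$; if $a=\alpha$,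 append $s$ to $\mathcal J$ and set $a=0$. (2c) Otherwise: append $m$ to $M$, set $m=1$, $a=0$, and repeat the following until a new cycle is found: compute $t_*:=\sigma_1(sj)$; if inNewCycle$(\mathcal I\cup\mathcal J,\sigma,M,t_* )$ is true, then a new cycle has been found: append $t_*$ to $\mathcal I$, append $j$ to $\mathcal F$, set $s=t_*$, and add $g(s)$ to $\mathcal G$; then, whether or not a new cycle was found, replace $sj$ by next$(\mathcal I,\sigma,M,j,sj)$ and $j$ by $j+1$. (3) Return $(\mathcal I\cup\mathcal J,\sigma,\mathcal F,M)$, together with $\mathcal G$. Storage. The cost of storing a point of $\mathbb C^n$ is $\rho(\mathbb C^n)=2n\,\rho(\mathbb R)$ bits and of an integer at most $d$ is $\rho(\mathbb N)$ bits, with $\rho(\mathbb R),\rho(\mathbb N)$ constants independent of $n,d,\alpha$. The space complexity in item 4 is counted in excess of the cost of storing $\sigma$ and the accumulator. *)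

theory Defs
  imports
    "HOL-Analysis.Analysis"
    "HOL-Probability.Probability_Mass_Function"
    "HOL-Combinatorics.Permutations"
    "HOL-Combinatorics.Orbits"
    "HOL-Algebra.Generated_Groups"
    "HOL-Library.While_Combinator"
    "Jordan_Normal_Form.Matrix"
begin

definition perm_group :: "'p set \<Rightarrow> ('p \<Rightarrow> 'p) monoid" where
  "perm_group \<Omega> = \<lparr>carrier = {\<pi>. \<pi> permutes \<Omega>}, mult = (\<circ>), one = id\<rparr>"

definition generates_transitive :: "'p set \<Rightarrow> ('p \<Rightarrow> 'p) \<Rightarrow> ('p \<Rightarrow> 'p) \<Rightarrow> bool" where
  "generates_transitive \<Omega> \<sigma>0 \<sigma>1 \<longleftrightarrow>
     (\<forall>x\<in>\<Omega>. \<forall>y\<in>\<Omega>. \<exists>h \<in> generate (perm_group \<Omega>) {\<sigma>0, \<sigma>1}. h x = y)"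

text \<open>Supports of the cycles of a permutation of \<open>\<Omega>\<close>; a fixed point \<open>x\<close> contributes the
  cycle \<open>{x}\<close>.\<close>

definition cycles_on :: "('p \<Rightarrow> 'p) \<Rightarrow> 'p set \<Rightarrow> 'p set set" where
  "cycles_on \<sigma> \<Omega> = orbit \<sigma> ` \<Omega>"

text \<open>A state is \<open>(S, j, F)\<close> with \<open>F\<close> the founder indices found so far. Positions are counted
  from 1, so the point \<open>s_j\<close> is \<open>S ! (j - 1)\<close>.\<close>

fun ms_step :: "('p \<Rightarrow> 'p) \<Rightarrow> ('p \<Rightarrow> 'p) \<Rightarrow> 'p list \<times> nat \<times> nat list \<Rightarrow> 'p list \<times> nat \<times> nat list"
where
  "ms_step \<sigma>0 \<sigma>1 (S, j, F) =
     (if \<sigma>0 (last S) \<notin> set S then (S @ [\<sigma>0 (last S)], j, F)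
      else (let f = while (\<lambda>i. \<sigma>1 (S ! (i - 1)) \<in> set S) Suc j
            in (S @ [\<sigma>1 (S ! (f - 1))], f + 1, F @ [f])))"

definition monodromy_solve ::
  "('p \<Rightarrow> 'p) \<Rightarrow> ('p \<Rightarrow> 'p) \<Rightarrow> nat \<Rightarrow> 'p \<Rightarrow> 'p list \<times> nat \<times> nat list" where
  "monodromy_solve \<sigma>0 \<sigma>1 d s1 =
     while (\<lambda>(S, j, F). length S < d) (ms_step \<sigma>0 \<sigma>1) ([s1], 1, [])"

definition founder_indices :: "('p \<Rightarrow> 'p) \<Rightarrow> ('p \<Rightarrow> 'p) \<Rightarrow> nat \<Rightarrow> 'p \<Rightarrow> nat list" where
  "founder_indices \<sigma>0 \<sigma>1 d s1 = snd (snd (monodromy_solve \<sigma>0 \<sigma>1 d s1))"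

definition largest_founder :: "('p \<Rightarrow> 'p) \<Rightarrow> ('p \<Rightarrow> 'p) \<Rightarrow> nat \<Rightarrow> 'p \<Rightarrow> nat" where
  "largest_founder \<sigma>0 \<sigma>1 d s1 =
     (let F = founder_indices \<sigma>0 \<sigma>1 d s1 in if F = [] then 0 else Max (set F))"

text \<open>The fields are the lists I, J, M, F, the integers m, j, a, the points sj, s and the
  accumulator of the algorithm. \<open>found\<close> is the number of solutions found so far, on which the
  stopping criterion is based; \<open>searching\<close> says that control is inside the loop that looks for a
  new cycle; \<open>queries\<close> is not part of the algorithm but counts the oracle evaluations.\<close>

record ('p, 'b) mc_state =
  initials :: "'p list"
  extras :: "'p list"
  sizes :: "nat list"
  founders :: "nat list"
  msize :: nat
  jpos :: nat
  apos :: nat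
  sj :: 'p
  cur :: 'p
  accum :: 'b
  found :: nat
  searching :: bool
  queries :: nat

text \<open>The subroutines return their result together with the number of queries they made.\<close>

fun probe :: "nat \<Rightarrow> ('p \<Rightarrow> 'p) \<Rightarrow> 'p set \<Rightarrow> 'p \<Rightarrow> bool \<times> nat" where
  "probe 0 \<sigma>0 K s = (True, 0)"
| "probe (Suc k) \<sigma>0 K s =
     (if \<sigma>0 s \<in> K then (False, 1)
      else (let (b, q) = probe k \<sigma>0 K (\<sigma>0 s) in (b, q + 1)))"

definition in_new_cycle ::
  "nat \<Rightarrow> 'p set \<Rightarrow> ('p \<Rightarrow> 'p) \<Rightarrow> nat list \<Rightarrow> 'p \<Rightarrow> bool \<times> nat" where
  "in_new_cycle \<alpha> K \<sigma>0 M s =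
     (if s \<in> K then (False, 0) else probe (min (Max (set M)) \<alpha> - 1) \<sigma>0 K s)"

definition next_point ::
  "'p list \<Rightarrow> ('p \<Rightarrow> 'p) \<Rightarrow> nat list \<Rightarrow> nat \<Rightarrow> 'p \<Rightarrow> 'p \<times> nat" where
  "next_point I \<sigma>0 M j x =
     (case find (\<lambda>k. j = sum_list (take (k - 1) M)) [2..<length M + 2] of
        Some k \<Rightarrow> (I ! (k - 1), 0)
      | None \<Rightarrow> (\<sigma>0 x, 1))"

definition mc_init :: "('p \<Rightarrow> 'b) \<Rightarrow> 'p \<Rightarrow> ('p, 'b) mc_state" where
  "mc_init g s1 =
     \<lparr>initials = [s1], extras = [], sizes = [], founders = [],
      msize = 1, jpos = 1, apos = 0, sj = s1, cur = s1, accum = g s1,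
      found = 1, searching = False, queries = 0\<rparr>"

definition mc_advance ::
  "('p \<Rightarrow> 'p) \<Rightarrow> ('p \<Rightarrow> 'b::ab_group_add) \<Rightarrow> nat \<Rightarrow> ('p, 'b) mc_state \<Rightarrow> ('p, 'b) mc_state" where
  "mc_advance \<sigma>0 g \<alpha> st =
     (let s = \<sigma>0 (cur st);
          st = st\<lparr>cur := s, queries := queries st + 1\<rparr>
      in if s \<noteq> last (initials st) then
           (let st = st\<lparr>msize := msize st + 1, apos := apos st + 1,
                        accum := accum st + g s, found := found st + 1\<rparr>
            in if apos st = \<alpha> then st\<lparr>extras := extras st @ [s], apos := 0\<rparr> else st)
         else st\<lparr>sizes := sizes st @ [msize st], msize := 1, apos := 0, searching := True\<rparr>)"

definition mc_search ::
  "('p \<Rightarrow> 'p) \<Rightarrow> ('p \<Rightarrow> 'p) \<Rightarrow> ('p \<Rightarrow> 'b::ab_group_add) \<Rightarrow> nat \<Rightarrow>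
   ('p, 'b) mc_state \<Rightarrow> ('p, 'b) mc_state" where
  "mc_search \<sigma>0 \<sigma>1 g \<alpha> st =
     (let t = \<sigma>1 (sj st);
          (is_new, q) =
            in_new_cycle \<alpha> (set (initials st) \<union> set (extras st)) \<sigma>0 (sizes st) t;
          st = (if is_new
                then st\<lparr>initials := initials st @ [t], founders := founders st @ [jpos st],
                        cur := t, accum := accum st + g t, found := found st + 1,
                        searching := False\<rparr>
                else st);
          (x, q') = next_point (initials st) \<sigma>0 (sizes st) (jpos st) (sj st)
      in st\<lparr>sj := x, jpos := jpos st + 1, queries := queries st + 1 + q + q'\<rparr>)"

definition mc_step ::
  "('p \<Rightarrow> 'p) \<Rightarrow> ('p \<Rightarrow> 'p) \<Rightarrow> ('p \<Rightarrow> 'b::ab_group_add) \<Rightarrow> nat \<Rightarrow>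
   ('p, 'b) mc_state \<Rightarrow> ('p, 'b) mc_state" where
  "mc_step \<sigma>0 \<sigma>1 g \<alpha> st =
     (if searching st then mc_search \<sigma>0 \<sigma>1 g \<alpha> st else mc_advance \<sigma>0 g \<alpha> st)"

text \<open>The stopping criterion is only tested at the head of the main loop.\<close>

definition mc_halted :: "nat \<Rightarrow> ('p, 'b) mc_state \<Rightarrow> bool" where
  "mc_halted d st \<longleftrightarrow> \<not> searching st \<and> found st = d"

text \<open>The value is \<open>None\<close> if the algorithm does not terminate.\<close>

definition mc_run ::
  "('p \<Rightarrow> 'p) \<Rightarrow> ('p \<Rightarrow> 'p) \<Rightarrow> ('p \<Rightarrow> 'b::ab_group_add) \<Rightarrow> nat \<Rightarrow> nat \<Rightarrow> 'p \<Rightarrow>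
   ('p, 'b) mc_state option" where
  "mc_run \<sigma>0 \<sigma>1 g \<alpha> d s1 =
     while_option (\<lambda>st. \<not> mc_halted d st) (mc_step \<sigma>0 \<sigma>1 g \<alpha>) (mc_init g s1)"

definition mc_visited ::
  "('p \<Rightarrow> 'p) \<Rightarrow> ('p \<Rightarrow> 'p) \<Rightarrow> ('p \<Rightarrow> 'b::ab_group_add) \<Rightarrow> nat \<Rightarrow> nat \<Rightarrow> 'p \<Rightarrow>
   ('p, 'b) mc_state set" where
  "mc_visited \<sigma>0 \<sigma>1 g \<alpha> d s1 =
     {(mc_step \<sigma>0 \<sigma>1 g \<alpha> ^^ k) (mc_init g s1) | k.
        \<forall>i<k. \<not> mc_halted d ((mc_step \<sigma>0 \<sigma>1 g \<alpha> ^^ i) (mc_init g s1))}"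

definition mc_time ::
  "('p \<Rightarrow> 'p) \<Rightarrow> ('p \<Rightarrow> 'p) \<Rightarrow> ('p \<Rightarrow> 'b::ab_group_add) \<Rightarrow> nat \<Rightarrow> nat \<Rightarrow> 'p \<Rightarrow> nat" where
  "mc_time \<sigma>0 \<sigma>1 g \<alpha> d s1 = queries (the (mc_run \<sigma>0 \<sigma>1 g \<alpha> d s1))"

definition mc_points :: "('p, 'b) mc_state \<Rightarrow> 'p list" where
  "mc_points st = initials st @ extras st @ [cur st, sj st]"

definition mc_ints :: "('p, 'b) mc_state \<Rightarrow> nat list" where
  "mc_ints st = sizes st @ founders st @ [msize st, jpos st, apos st, found st]"

text \<open>Besides the fields of the state there are two points local to a step (the candidate for a
  new cycle, and its copy inside inNewCycle) and six further integers: the bound and the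
  counter of the loop in inNewCycle, the index and the partial sum used to test the
  condition in next, and the parameters \<open>d\<close> and \<open>min \<alpha> d\<close> (a larger \<open>\<alpha>\<close> acts like
  \<open>d\<close>). All lists only grow, so it is enough to look at the states between two steps.\<close>

definition stored_points :: "('p, 'b) mc_state \<Rightarrow> nat" where
  "stored_points st = length (mc_points st) + 2"

definition stored_ints :: "('p, 'b) mc_state \<Rightarrow> nat" where
  "stored_ints st = length (mc_ints st) + 6"

text \<open>A point of \<open>\<complex>\<^sup>n\<close> costs \<open>2 n \<rho>R\<close> bits and an integer costs \<open>\<rho>N\<close> bits; the oracles and the
  accumulator are not counted.\<close>

definition state_bits :: "real \<Rightarrow> real \<Rightarrow> nat \<Rightarrow> ('p, 'b) mc_state \<Rightarrow> real" where
  "state_bits \<rho>R \<rho>N n st =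
     2 * real n * \<rho>R * real (stored_points st) + \<rho>N * real (stored_ints st)"

definition mc_space ::
  "real \<Rightarrow> real \<Rightarrow> nat \<Rightarrow> ('p \<Rightarrow> 'p) \<Rightarrow> ('p \<Rightarrow> 'p) \<Rightarrow> ('p \<Rightarrow> 'b::ab_group_add) \<Rightarrow> nat \<Rightarrow> nat \<Rightarrow> 'p \<Rightarrow>
   real" where
  "mc_space \<rho>R \<rho>N n \<sigma>0 \<sigma>1 g \<alpha> d s1 =
     Max (state_bits \<rho>R \<rho>N n ` mc_visited \<sigma>0 \<sigma>1 g \<alpha> d s1)"

definition random_perm :: "'p set \<Rightarrow> ('p \<Rightarrow> 'p) pmf" where
  "random_perm \<Omega> = pmf_of_set {\<pi>. \<pi> permutes \<Omega>}"

definition random_transitive_pair :: "'p set \<Rightarrow> (('p \<Rightarrow> 'p) \<times> ('p \<Rightarrow> 'p)) pmf" where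
  "random_transitive_pair \<Omega> =
     cond_pmf (pair_pmf (random_perm \<Omega>) (random_perm \<Omega>))
       {(\<sigma>0, \<sigma>1). generates_transitive \<Omega> \<sigma>0 \<sigma>1}"

text \<open>The inner integral is the logarithmic integral li(t). The value at \<open>t = 1\<close>, where li
  diverges, has no influence.\<close>

definition golomb_dickman :: real where
  "golomb_dickman =
     integral {0..1} (\<lambda>t. exp (integral {0..t} (\<lambda>u. 1 / ln u)))"

end

theory Submission
  imports Defs
begin

text \<open>The explored points, listed in the monodromy ordering, form a concatenation of segments
  \<open>c, \<sigma>0 c, \<sigma>0\<^sup>2 c, \<dots>\<close>, one for each initial solution \<open>c\<close>, and all segments but possibly the
  last are complete cycles of \<open>\<sigma>0\<close>. The state of the algorithm is a compressed form of this list
  (\<open>explored\<close>): the starting points and lengths of the segments, together with every \<open>\<alpha>\<close>-th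
  point of each segment. Three facts make the compression harmless.

  \<^item> \<open>milestone_ahead\<close>: from any point of a complete cycle at most \<open>\<alpha> - 1\<close> and at most
    (cycle length) - 1 steps of \<open>\<sigma>0\<close> lead to a stored point, while from a point outside they never
    do. Hence inNewCycle decides membership in the explored list.
  \<^item> \<open>trail_Suc\<close>: the partial sums of the segment lengths are the positions at which a new
    segment starts, so next moves from \<open>s_j\<close> to \<open>s_(j + 1)\<close>.
  \<^item> \<open>transitive_invariant_set\<close>: if all explored points have been tried without success, then
    the explored set is closed under both permutations and hence everything, so the search for a
    new cycle succeeds as long as points are missing.

  Therefore the algorithm simulates MonodromySolve, and both find the same founder indices. This is
  recorded by an invariant (\<open>invariant_advance\<close>, \<open>invariant_search\<close>), from which the
  accumulator and the query count are read off at the end: following the cycles costs \<open>d - 1\<close>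
  queries in total, and each of the \<open>j\<^sup>*\<close> search steps costs at most one query of \<open>\<sigma>1\<close>, one query in
  next and \<open>min (max M) \<alpha> - 1\<close> queries in inNewCycle. A segment of length \<open>m\<close> stores
  \<open>\<lceil>m / \<alpha>\<rceil>\<close> points, which gives the storage bounds.

  For the expectations, the number of stored points is at most \<open>d / \<alpha> + r\<close> up to a constant, where
  \<open>r\<close> is the number of cycles of \<open>\<sigma>0\<close>. Over all permutations the mean of \<open>r\<close> is at most the
  harmonic number \<open>H_d\<close> (\<open>sum_card_cycles_le\<close>). A random pair generates a transitive group with
  probability at least \<open>1/2\<close> (\<open>card_transitive_pairs\<close>, a union bound over the invariant sets), so
  conditioning on transitivity at most doubles the mean of the nonnegative \<open>r\<close>, and
  \<open>H_d \<le> 1 + ln d\<close>. The number of queries is \<open>O(d min(d, \<alpha>))\<close> for every input; passing to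
  \<open>min(\<lambda> d, \<alpha>)\<close> changes this by a constant factor because the Golomb-Dickman constant \<open>\<lambda>\<close> is
  positive (\<open>golomb_dickman_pos\<close>).\<close>

section \<open>Lists of explored and of stored points\<close>

definition cycle_prefix :: "('p \<Rightarrow> 'p) \<Rightarrow> 'p \<Rightarrow> nat \<Rightarrow> 'p list" where
  "cycle_prefix f c m = map (\<lambda>i. (f ^^ i) c) [0..<m]"

text \<open>The list of explored points in the monodromy ordering, if \<open>I\<close> are the initial solutions and \<open>L\<close>
  the lengths of the segments explored from them.\<close>

definition trail :: "('p \<Rightarrow> 'p) \<Rightarrow> 'p list \<Rightarrow> nat list \<Rightarrow> 'p list" where
  "trail f I L = concat (map2 (cycle_prefix f) I L)"

text \<open>The additional stored solutions. Offset 0 is left out since the initial solutions themselves are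
  stored in a separate list.\<close>

definition milestones :: "('p \<Rightarrow> 'p) \<Rightarrow> nat \<Rightarrow> 'p list \<Rightarrow> nat list \<Rightarrow> 'p list" where
  "milestones f \<alpha> I L =
     concat (map2 (\<lambda>c m. map (\<lambda>i. (f ^^ i) c) (filter ((dvd) \<alpha>) [1..<m])) I L)"

lemma trail_snoc:
  "length I = length L \<Longrightarrow> trail f (I @ [c]) (L @ [m]) = trail f I L @ cycle_prefix f c m"
  by (simp add: trail_def)

lemma milestones_snoc:
  "length I = length L \<Longrightarrow> milestones f \<alpha> (I @ [c]) (L @ [m]) =
     milestones f \<alpha> I L @ map (\<lambda>i. (f ^^ i) c) (filter ((dvd) \<alpha>) [1..<m])"
  by (simp add: milestones_def)

lemma cycle_prefix_Suc: "cycle_prefix f c (Suc m) = cycle_prefix f c m @ [(f ^^ m) c]"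
  by (simp add: cycle_prefix_def)

lemma set_trail:
  "set (trail f I L) = {(f ^^ i) c | c m i. (c, m) \<in> set (zip I L) \<and> i < m}"
  by (auto simp: trail_def cycle_prefix_def; blast)

lemma in_trailI: "(c, m) \<in> set (zip I L) \<Longrightarrow> i < m \<Longrightarrow> (f ^^ i) c \<in> set (trail f I L)"
  unfolding set_trail by blast

lemma set_milestones:
  "set (milestones f \<alpha> I L) =
     {(f ^^ i) c | c m i. (c, m) \<in> set (zip I L) \<and> 0 < i \<and> i < m \<and> \<alpha> dvd i}"
  by (auto simp: milestones_def Suc_le_eq; blast)

lemma length_trail: "length I = length L \<Longrightarrow> length (trail f I L) = sum_list L"
  by (induction I L rule: list_induct2) (auto simp: trail_def cycle_prefix_def)

lemma distinct_cycle_prefix: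
  "distinct (trail f I L) \<Longrightarrow> (c, m) \<in> set (zip I L) \<Longrightarrow> distinct (cycle_prefix f c m)"
  by (auto simp: trail_def distinct_concat_iff)

lemma length_multiples_upto:
  "length (filter ((dvd) \<alpha>) [1..<Suc m]) = m div \<alpha>"
proof (induction m)
  case (Suc m)
  then show ?case by (simp add: div_Suc dvd_eq_mod_eq_0)
qed simp

text \<open>A segment of length \<open>m\<close> contains the offsets \<open>0, \<alpha>, 2\<alpha>, \<dots>\<close> below \<open>m\<close>, and
  \<open>Suc ((m - 1) div \<alpha>)\<close> is the natural-number form of \<open>\<lceil>m / \<alpha>\<rceil>\<close>.\<close>

lemma length_milestones:
  "length I = length L \<Longrightarrow> 0 \<notin> set L \<Longrightarrow>
     length I + length (milestones f \<alpha> I L) = (\<Sum>m\<leftarrow>L. Suc ((m - 1) div \<alpha>))"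
proof (induction I L rule: list_induct2)
  case (Cons c I m L)
  then obtain k where "m = Suc k" by (cases m) auto
  with Cons length_multiples_upto[of \<alpha> k] show ?case by (auto simp: milestones_def)
qed (simp add: milestones_def)

lemma trail_nth:
  "length I = length L \<Longrightarrow> k < length L \<Longrightarrow> i < L ! k \<Longrightarrow>
     trail f I L ! (sum_list (take k L) + i) = (f ^^ i) (I ! k)"
proof (induction I L arbitrary: k rule: list_induct2)
  case (Cons c I m L)
  then show ?case
    by (cases k) (auto simp: trail_def cycle_prefix_def nth_append)
qed simp

lemma split_position:
  fixes L :: "nat list"
  shows "j < sum_list L \<Longrightarrow> \<exists>k i. k < length L \<and> i < L ! k \<and> j = sum_list (take k L) + i"
proof (induction L arbitrary: j)
  case (Cons m L)
  show ?case
  proof (cases "j < m")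
    case True
    then show ?thesis by (intro exI[of _ 0] exI[of _ j]) auto
  next
    case False
    with Cons.prems have "j - m < sum_list L" by simp
    from Cons.IH[OF this] obtain k i where
      "k < length L" "i < L ! k" "j - m = sum_list (take k L) + i" by blast
    with False show ?thesis by (intro exI[of _ "Suc k"] exI[of _ i]) auto
  qed
qed simp

lemma trail_closed:
  assumes "length I = length M" "\<forall>(c, m) \<in> set (zip I M). (f ^^ m) c = c"
    and "x \<in> set (trail f I M)"
  shows "f x \<in> set (trail f I M)"
proof -
  from assms(3) obtain c m p where cm: "(c, m) \<in> set (zip I M)" "p < m" "x = (f ^^ p) c"
    by (auto simp: set_trail)
  have fx: "f x = (f ^^ Suc p) c" using cm by simp
  moreover have "(f ^^ Suc p) c \<in> set (trail f I M)"
  proof (cases "Suc p = m")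
    case True
    then have "(f ^^ Suc p) c = (f ^^ 0) c" using assms(2) cm by auto
    then show ?thesis using in_trailI[OF cm(1), of 0 f] cm(2) by simp
  next
    case False
    then show ?thesis using in_trailI[OF cm(1)] cm(2) by (metis Suc_lessI)
  qed
  ultimately show ?thesis by simp
qed

lemma orbit_eq_cycle_prefix:
  assumes "(f ^^ m) c = c" "0 < m"
  shows "orbit f c = set (cycle_prefix f c m)"
  using orbit_altdef_bounded[OF assms] by (auto simp: cycle_prefix_def)

lemma initials_and_milestones_in_trail:
  assumes "length I = length L" "0 \<notin> set L"
  shows "set I \<union> set (milestones f \<alpha> I L) \<subseteq> set (trail f I L)"
proof -
  have "c \<in> set (trail f I L)" if "c \<in> set I" for c
  proof -
    from that obtain i where i: "i < length I" "c = I ! i" by (auto simp: in_set_conv_nth)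
    then have "(c, L ! i) \<in> set (zip I L)" using assms(1) by (auto simp: set_zip)
    moreover have "0 < L ! i" using assms i by (metis gr0I nth_mem)
    ultimately show ?thesis using in_trailI[of c "L ! i" I L 0 f] by simp
  qed
  then show ?thesis by (auto simp: set_milestones intro: in_trailI)
qed

section \<open>The subroutines\<close>

text \<open>The sums that next tests are exactly the positions at which a segment starts; there the successor
  is the stored initial solution, and elsewhere it is the \<open>\<sigma>0\<close>-image of the current point. The list
  \<open>L\<close> may be longer than \<open>M\<close> by one entry because a cycle that has just been found is
  not yet among the completed sizes.\<close>

lemma trail_Suc:
  assumes len: "length I = length L" and pos: "0 \<notin> set L"
    and j: "0 < j" "j < sum_list L"
    and M: "L = M \<or> L = M @ [m]"
  shows "fst (next_point I f M j (trail f I L ! (j - 1))) = trail f I L ! j"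
    and "snd (next_point I f M j (trail f I L ! (j - 1))) \<le> 1"
proof -
  let ?P = "\<lambda>k. j = sum_list (take (k - 1) M)"
  have "fst (next_point I f M j (trail f I L ! (j - 1))) = trail f I L ! j \<and>
        snd (next_point I f M j (trail f I L ! (j - 1))) \<le> 1"
  proof (cases "find ?P [2..<length M + 2]")
    case (Some k)
    then have Pk: "?P k" "k \<in> set [2..<length M + 2]"
      unfolding find_Some_iff by (blast, metis nth_mem)
    then have k: "?P k" "2 \<le> k" "k < length M + 2" by auto
    from M k have tk: "take (k - 1) L = take (k - 1) M" by auto
    have "k - 1 < length L"
    proof (rule ccontr)
      assume "\<not> k - 1 < length L"
      then have "take (k - 1) L = L" by simp
      with tk k(1) j show False by simp
    qed
    moreover from this pos have "0 < L ! (k - 1)" by (metis gr0I nth_mem)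
    ultimately have "trail f I L ! j = I ! (k - 1)"
      using trail_nth[OF len, of "k - 1" 0 f] k(1) tk by simp
    with Some show ?thesis by (simp add: next_point_def)
  next
    case None
    then have no: "\<And>k. 2 \<le> k \<Longrightarrow> k < length M + 2 \<Longrightarrow> \<not> ?P k"
      unfolding find_None_iff set_upt by auto
    from split_position[OF j(2)] obtain k i where
      ki: "k < length L" "i < L ! k" "j = sum_list (take k L) + i" by blast
    have "i \<noteq> 0"
    proof
      assume "i = 0"
      with ki j have "k \<noteq> 0" by (intro notI) simp
      moreover have "k \<le> length M" "take k L = take k M" using M ki by auto
      ultimately show False using no[of "Suc k"] ki \<open>i = 0\<close> by auto
    qed
    then obtain i' where i': "i = Suc i'" by (cases i) auto
    have "trail f I L ! j = f (trail f I L ! (j - 1))"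
      using trail_nth[OF len ki(1), of i f] trail_nth[OF len ki(1), of i' f] ki i' by simp
    with None show ?thesis by (simp add: next_point_def)
  qed
  then show "fst (next_point I f M j (trail f I L ! (j - 1))) = trail f I L ! j"
    and "snd (next_point I f M j (trail f I L ! (j - 1))) \<le> 1" by auto
qed

lemma probe_correct:
  "fst (probe k f K s) \<longleftrightarrow> (\<forall>i. 1 \<le> i \<and> i \<le> k \<longrightarrow> (f ^^ i) s \<notin> K)"
  "snd (probe k f K s) \<le> k"
proof (induction k arbitrary: s)
  case (Suc k)
  {
    case 1
    show ?case
    proof (cases "f s \<in> K")
      case True
      then have "\<not> (\<forall>i. 1 \<le> i \<and> i \<le> Suc k \<longrightarrow> (f ^^ i) s \<notin> K)"
        by (intro notI) (drule spec[of _ 1], simp)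
      moreover from True have "\<not> fst (probe (Suc k) f K s)" by simp
      ultimately show ?thesis by (simp only: simp_thms)
    next
      case False
      have "(\<forall>i. 1 \<le> i \<and> i \<le> Suc k \<longrightarrow> (f ^^ i) s \<notin> K) \<longleftrightarrow>
            (\<forall>i. 1 \<le> i \<and> i \<le> k \<longrightarrow> (f ^^ i) (f s) \<notin> K)" (is "?l = ?r")
      proof
        assume l: ?l
        show ?r
        proof (intro allI impI)
          fix i assume "1 \<le> i \<and> i \<le> k"
          then have "1 \<le> Suc i \<and> Suc i \<le> Suc k" by simp
          from l[THEN spec, THEN mp, OF this] show "(f ^^ i) (f s) \<notin> K" by (simp add: funpow_swap1)
        qed
      next
        assume r: ?r
        show ?l
        proof (intro allI impI)
          fix i assume i: "1 \<le> i \<and> i \<le> Suc k"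
          then obtain i' where [simp]: "i = Suc i'" by (cases i) auto
          show "(f ^^ i) s \<notin> K"
            using r i False by (cases "i' = 0") (auto simp: funpow_swap1)
        qed
      qed
      moreover from False have "fst (probe (Suc k) f K s) = fst (probe k f K (f s))"
        by (simp add: case_prod_beta)
      ultimately show ?thesis by (simp only: Suc.IH(1))
    qed
  next
    case 2
    from Suc.IH(2)[of "f s"] show ?case by (simp add: case_prod_beta)
  }
qed auto

lemma in_new_cycle_correct:
  "fst (in_new_cycle \<alpha> K f M s) \<longleftrightarrow> (\<forall>i \<le> min (Max (set M)) \<alpha> - 1. (f ^^ i) s \<notin> K)"
  "snd (in_new_cycle \<alpha> K f M s) \<le> min (Max (set M)) \<alpha> - 1"
proof -
  show "fst (in_new_cycle \<alpha> K f M s) \<longleftrightarrow> (\<forall>i \<le> min (Max (set M)) \<alpha> - 1. (f ^^ i) s \<notin> K)"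
  proof (cases "s \<in> K")
    case True
    then have "\<not> (\<forall>i \<le> min (Max (set M)) \<alpha> - 1. (f ^^ i) s \<notin> K)"
      by (intro notI) (drule spec[of _ 0], simp)
    moreover from True have "\<not> fst (in_new_cycle \<alpha> K f M s)" by (simp add: in_new_cycle_def)
    ultimately show ?thesis by (simp only: simp_thms)
  next
    case False
    have all_from_0: "(\<forall>i. 1 \<le> i \<and> i \<le> k \<longrightarrow> (f ^^ i) s \<notin> K) \<longleftrightarrow> (\<forall>i \<le> k. (f ^^ i) s \<notin> K)" for k
    proof (intro iffI allI impI)
      fix i assume "\<forall>i. 1 \<le> i \<and> i \<le> k \<longrightarrow> (f ^^ i) s \<notin> K" "i \<le> k"
      with False show "(f ^^ i) s \<notin> K" by (cases i) auto
    qed auto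
    have "in_new_cycle \<alpha> K f M s = probe (min (Max (set M)) \<alpha> - 1) f K s"
      using False by (simp add: in_new_cycle_def)
    then show ?thesis by (simp only: probe_correct(1) all_from_0)
  qed
  show "snd (in_new_cycle \<alpha> K f M s) \<le> min (Max (set M)) \<alpha> - 1"
    by (cases "s \<in> K") (simp_all only: in_new_cycle_def probe_correct(2) if_True if_False snd_conv le0)
qed

text \<open>This is the reason why inNewCycle recognises old cycles. Going forward from offset \<open>p\<close> of a
  complete cycle of length \<open>m\<close>, one meets a stored point at the next multiple of \<open>\<alpha>\<close> or, if
  that lies beyond the end, at the initial solution after \<open>m - p\<close> steps. Nothing has to be done if
  \<open>\<alpha>\<close> divides \<open>p\<close>; otherwise \<open>p > 0\<close>, so the distances are at most \<open>\<alpha> - 1\<close> and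
  \<open>m - 1\<close>.\<close>

lemma milestone_ahead:
  assumes M: "length I = length M" "\<forall>(c, m) \<in> set (zip I M). (f ^^ m) c = c"
    and t: "t \<in> set (trail f I M)" and \<alpha>: "1 \<le> \<alpha>"
  shows "\<exists>i \<le> min (Max (set M)) \<alpha> - 1. (f ^^ i) t \<in> set I \<union> set (milestones f \<alpha> I M)"
proof -
  from t obtain c m p where cm: "(c, m) \<in> set (zip I M)" "p < m" "t = (f ^^ p) c"
    by (auto simp: set_trail)
  have cI: "c \<in> set I" and mM: "m \<in> set M"
    using cm(1) by (auto dest: set_zip_leftD set_zip_rightD)
  have mMax: "m \<le> Max (set M)" using mM by simp
  have fm: "(f ^^ m) c = c" using M(2) cm(1) by auto
  (* The distance to the next stored point, which is the smaller of the two candidates. *)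
  define i where "i = (if p mod \<alpha> = 0 then 0 else min (\<alpha> - p mod \<alpha>) (m - p))"
  have pm: "p mod \<alpha> < \<alpha>" using \<alpha> by simp
  have "p mod \<alpha> \<noteq> 0 \<Longrightarrow> 0 < p" by (cases p) auto
  then have "i \<le> min m \<alpha> - 1" using cm(2) by (auto simp: i_def)
  then have bound: "i \<le> min (Max (set M)) \<alpha> - 1" using mMax by linarith
  have fit: "(f ^^ i) t = (f ^^ (i + p)) c" by (simp add: cm(3) funpow_add)
  have "i + p = m \<or> i + p < m \<and> \<alpha> dvd i + p"
  proof (cases "p mod \<alpha> = 0")
    case True
    then show ?thesis using cm(2) by (auto simp: i_def)
  next
    case False
    show ?thesis
    proof (cases "m - p \<le> \<alpha> - p mod \<alpha>")
      case True
      then show ?thesis using False cm(2) by (auto simp: i_def)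
    next
      case small: False
      have "\<alpha> - p mod \<alpha> + p = \<alpha> * (p div \<alpha> + 1)"
        using pm mult_div_mod_eq[of \<alpha> p] unfolding distrib_left by linarith
      then have "\<alpha> dvd \<alpha> - p mod \<alpha> + p" by simp
      then show ?thesis using False small by (auto simp: i_def)
    qed
  qed
  then have "(f ^^ (i + p)) c \<in> set I \<union> set (milestones f \<alpha> I M)"
  proof
    assume "i + p = m" then show ?thesis using fm cI by simp
  next
    assume a: "i + p < m \<and> \<alpha> dvd i + p"
    show ?thesis
    proof (cases "i + p = 0")
      case True then show ?thesis using cI by simp
    next
      case False
      then show ?thesis unfolding set_milestones using a cm(1) by blast
    qed
  qed
  with bound fit show ?thesis by auto
qed

section \<open>Sets preserved by the generated group\<close>

lemma group_perm_group: "group (perm_group \<Omega>)"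
proof (rule groupI)
  fix x assume x: "x \<in> carrier (perm_group \<Omega>)"
  then have "inv_into UNIV x \<in> carrier (perm_group \<Omega>)"
    by (simp add: perm_group_def permutes_inv)
  moreover have "inv_into UNIV x \<otimes>\<^bsub>perm_group \<Omega>\<^esub> x = \<one>\<^bsub>perm_group \<Omega>\<^esub>"
    using x by (simp add: perm_group_def permutes_inv_o)
  ultimately show "\<exists>y\<in>carrier (perm_group \<Omega>). y \<otimes>\<^bsub>perm_group \<Omega>\<^esub> x = \<one>\<^bsub>perm_group \<Omega>\<^esub>"
    by blast
qed (auto simp: perm_group_def permutes_compose permutes_id comp_assoc)

lemma inv_perm_group:
  assumes "h permutes \<Omega>"
  shows "inv\<^bsub>perm_group \<Omega>\<^esub> h = inv_into UNIV h"
proof -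
  interpret group "perm_group \<Omega>" by (rule group_perm_group)
  show ?thesis
    by (rule inv_equality) (use assms in \<open>simp_all add: perm_group_def permutes_inv permutes_inv_o\<close>)
qed

text \<open>Equality, and not just inclusion, passes from the generators to their inverses.\<close>

lemma generate_preserves:
  assumes "\<sigma>0 permutes \<Omega>" "\<sigma>1 permutes \<Omega>" "\<sigma>0 ` A = A" "\<sigma>1 ` A = A"
    and "h \<in> generate (perm_group \<Omega>) {\<sigma>0, \<sigma>1}"
  shows "h ` A = A"
  using assms(5)
proof induction
  case one
  then show ?case by (simp add: perm_group_def)
next
  case (incl h)
  then show ?case using assms by auto
next
  case (inv h)
  then have h: "h permutes \<Omega>" "h ` A = A" using assms by auto
  have "inv_into UNIV h ` A = inv_into UNIV h ` h ` A" using h by simp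
  also have "\<dots> = A" using permutes_inv_o(2)[OF h(1)] by (simp add: image_comp)
  finally show ?case using inv_perm_group[OF h(1)] by simp
next
  case (eng h1 h2)
  have "h1 \<otimes>\<^bsub>perm_group \<Omega>\<^esub> h2 = h1 \<circ> h2" by (simp add: perm_group_def)
  then show ?case using eng.IH by (simp only: image_comp[symmetric])
qed

lemma transitive_invariant_set:
  assumes "finite \<Omega>" "\<sigma>0 permutes \<Omega>" "\<sigma>1 permutes \<Omega>" "generates_transitive \<Omega> \<sigma>0 \<sigma>1"
    and A: "A \<subseteq> \<Omega>" "x \<in> A" "\<sigma>0 ` A \<subseteq> A" "\<sigma>1 ` A \<subseteq> A"
  shows "A = \<Omega>"
proof -
  have "finite A" using A(1) assms(1) finite_subset by blast
  then have eq: "\<sigma>0 ` A = A" "\<sigma>1 ` A = A"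
    using A assms(2,3) by (meson endo_inj_surj inj_on_subset permutes_inj subset_UNIV)+
  have "y \<in> A" if "y \<in> \<Omega>" for y
  proof -
    have "x \<in> \<Omega>" using A by blast
    with that assms(4) obtain h where
      h: "h \<in> generate (perm_group \<Omega>) {\<sigma>0, \<sigma>1}" "h x = y"
      unfolding generates_transitive_def by blast
    with generate_preserves[OF assms(2,3) eq h(1)] A(2) show ?thesis by blast
  qed
  with A(1) show ?thesis by blast
qed

section \<open>One round of MonodromySolve\<close>

lemma monodromy_solve_done:
  "\<not> length S < d \<Longrightarrow> while (\<lambda>(S, j, F). length S < d) (ms_step \<sigma>0 \<sigma>1) (S, j, F) = (S, j, F)"
  by (subst while_unfold) simp

lemma monodromy_solve_step:
  "length S < d \<Longrightarrow>
     while (\<lambda>(S, j, F). length S < d) (ms_step \<sigma>0 \<sigma>1) (S, j, F) =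
     while (\<lambda>(S, j, F). length S < d) (ms_step \<sigma>0 \<sigma>1) (ms_step \<sigma>0 \<sigma>1 (S, j, F))"
  by (subst while_unfold) simp

text \<open>An unsuccessful index can be skipped before the round begins. This lets one index of
  MonodromySolve's inner loop correspond to one search step of the other algorithm.\<close>

lemma ms_step_skip:
  assumes "\<sigma>0 (last S) \<in> set S" "\<sigma>1 (S ! (j - 1)) \<in> set S"
  shows "ms_step \<sigma>0 \<sigma>1 (S, j, F) = ms_step \<sigma>0 \<sigma>1 (S, Suc j, F)"
proof -
  have "while (\<lambda>i. \<sigma>1 (S ! (i - 1)) \<in> set S) Suc j =
        while (\<lambda>i. \<sigma>1 (S ! (i - 1)) \<in> set S) Suc (Suc j)"
    by (subst while_unfold) (use assms in simp)
  then show ?thesis using assms by simp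
qed

lemma ms_step_found:
  assumes "\<sigma>0 (last S) \<in> set S" "\<sigma>1 (S ! (j - 1)) \<notin> set S"
  shows "ms_step \<sigma>0 \<sigma>1 (S, j, F) = (S @ [\<sigma>1 (S ! (j - 1))], Suc j, F @ [j])"
proof -
  have "while (\<lambda>i. \<sigma>1 (S ! (i - 1)) \<in> set S) Suc j = j"
    by (subst while_unfold) (use assms in simp)
  then show ?thesis using assms by simp
qed

section \<open>An invariant of the algorithm\<close>

text \<open>A cycle enters \<open>sizes\<close> only when it is completed. While it is being followed, its explored
  length is \<open>msize\<close>; during a search all segments are complete.\<close>

definition segment_lengths :: "('p, 'b) mc_state \<Rightarrow> nat list" where
  "segment_lengths st = sizes st @ (if searching st then [] else [msize st])"

definition explored :: "('p \<Rightarrow> 'p) \<Rightarrow> ('p, 'b) mc_state \<Rightarrow> 'p list" where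
  "explored f st = trail f (initials st) (segment_lengths st)"

locale monodromy_run =
  fixes \<Omega> :: "'p set" and \<sigma>0 \<sigma>1 :: "'p \<Rightarrow> 'p" and s1 :: 'p and \<alpha> :: nat
    and g :: "'p \<Rightarrow> 'b::ab_group_add"
  assumes finite_points: "finite \<Omega>"
    and perm0: "\<sigma>0 permutes \<Omega>" and perm1: "\<sigma>1 permutes \<Omega>"
    and transitive: "generates_transitive \<Omega> \<sigma>0 \<sigma>1"
    and start: "s1 \<in> \<Omega>" and alpha_pos: "1 \<le> \<alpha>"
begin

definition probe_bound :: nat where
  "probe_bound = min (Max (card ` cycles_on \<sigma>0 \<Omega>)) \<alpha>"

text \<open>The invariant has four parts. The first one says that the stored data encode the list of explored
  points: the segments are disjoint, completed segments are whole cycles, and every point has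
  entered the accumulator once.\<close>

definition well_explored :: "('p, 'b) mc_state \<Rightarrow> bool" where
  "well_explored st \<longleftrightarrow>
     length (initials st) = length (segment_lengths st) \<and> 0 \<notin> set (segment_lengths st) \<and>
     distinct (explored \<sigma>0 st) \<and> set (explored \<sigma>0 st) \<subseteq> \<Omega> \<and>
     length (explored \<sigma>0 st) = found st \<and> s1 \<in> set (explored \<sigma>0 st) \<and>
     (\<forall>(c, m) \<in> set (zip (initials st) (sizes st)). (\<sigma>0 ^^ m) c = c) \<and>
     distinct (map (orbit \<sigma>0) (initials st)) \<and>
     extras st = milestones \<sigma>0 \<alpha> (initials st) (segment_lengths st) \<and>
     apos st = (msize st - 1) mod \<alpha> \<and>
     (if searching st then msize st = 1 \<and> found st < card \<Omega> else cur st = last (explored \<sigma>0 st)) \<and>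
     accum st = (\<Sum>x\<leftarrow>explored \<sigma>0 st. g x)"

text \<open>The position \<open>jpos\<close> is one-based, and all points before it have already been mapped into the
  explored set. Outside a search the last position tried is the last founder index.\<close>

definition well_positioned :: "('p, 'b) mc_state \<Rightarrow> bool" where
  "well_positioned st \<longleftrightarrow>
     1 \<le> jpos st \<and> jpos st \<le> found st \<and> sj st = explored \<sigma>0 st ! (jpos st - 1) \<and>
     (\<forall>i < jpos st - 1. \<sigma>1 (explored \<sigma>0 st ! i) \<in> set (explored \<sigma>0 st)) \<and>
     Suc (length (founders st)) = length (initials st) \<and>
     (\<forall>f \<in> set (founders st). f < jpos st) \<and>
     (\<not> searching st \<longrightarrow> jpos st - 1 = (if founders st = [] then 0 else Max (set (founders st))))"

text \<open>The main loop makes one query for each point that it finds and one for each cycle that it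
  completes. Except for \<open>s1\<close>, the remaining points were found by successful searches, and these
  are as many as the completed cycles, or one fewer while a search is going on. This gives
  \<open>found - 1\<close> queries, plus one during a search. The \<open>jpos - 1\<close> search steps contribute at
  most \<open>probe_bound + 1\<close> queries each.\<close>

definition within_budget :: "('p, 'b) mc_state \<Rightarrow> bool" where
  "within_budget st \<longleftrightarrow>
     queries st \<le> found st - 1 + (if searching st then 1 else 0) +
                  (jpos st - 1) * (probe_bound + 1)"

text \<open>Outcomes are compared instead of steps because no round of MonodromySolve corresponds to an
  unsuccessful search step.\<close>

definition same_outcome :: "('p, 'b) mc_state \<Rightarrow> bool" where
  "same_outcome st \<longleftrightarrow>
     while (\<lambda>(S, j, F). length S < card \<Omega>) (ms_step \<sigma>0 \<sigma>1)
        (explored \<sigma>0 st, jpos st, founders st) = monodromy_solve \<sigma>0 \<sigma>1 (card \<Omega>) s1"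

definition invariant :: "('p, 'b) mc_state \<Rightarrow> bool" where
  "invariant st \<longleftrightarrow>
     well_explored st \<and> well_positioned st \<and> within_budget st \<and> same_outcome st"

lemmas invariant_defs =
  invariant_def well_explored_def well_positioned_def within_budget_def same_outcome_def

lemma self_in_orbit: "x \<in> orbit \<sigma>0 x"
  by (rule permutation_self_in_orbit) (use perm0 finite_points permutation_permutes in blast)

lemma invariant_init: "invariant (mc_init g s1)"
  using start
  by (simp add: invariant_defs mc_init_def explored_def segment_lengths_def trail_def
      cycle_prefix_def milestones_def monodromy_solve_def)

lemma inj0: "inj \<sigma>0"
  using perm0 permutes_inj by blast

text \<open>A closed subset of a finite set is permuted by the injection \<open>\<sigma>0\<close>, so it also absorbs preimages.
  Orbits that start outside an explored union of cycles hence never enter it.\<close>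

lemma closed_reflects:
  assumes "A \<subseteq> \<Omega>" "\<And>x. x \<in> A \<Longrightarrow> \<sigma>0 x \<in> A" "\<sigma>0 y \<in> A"
  shows "y \<in> A"
proof -
  have "finite A" using assms(1) finite_points finite_subset by blast
  then have "\<sigma>0 ` A = A" using assms(2) inj0 by (intro endo_inj_surj) (auto intro: inj_on_subset)
  with assms(3) obtain x where "x \<in> A" "\<sigma>0 x = \<sigma>0 y" by (metis imageE)
  then show ?thesis using inj0 by (metis injD)
qed

lemma closed_reflects_funpow:
  assumes "A \<subseteq> \<Omega>" "\<And>x. x \<in> A \<Longrightarrow> \<sigma>0 x \<in> A" "(\<sigma>0 ^^ i) y \<in> A"
  shows "y \<in> A"
  using assms(3) by (induction i) (use closed_reflects[OF assms(1,2)] in auto)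

text \<open>The main loop either finds a point or closes the current cycle. A point that is not the initial
  solution of its cycle is new: it cannot lie in a completed cycle because its \<open>\<sigma>0\<close>-preimage does
  not, and it cannot lie inside the current segment because the preimages there are earlier points
  of that segment. So the algorithm and MonodromySolve take the same branch.\<close>

lemma invariant_advance:
  assumes inv: "invariant st" and adv: "\<not> searching st" and going: "\<not> mc_halted (card \<Omega>) st"
  shows "invariant (mc_advance \<sigma>0 g \<alpha> st)"
proof -
  define I where "I = butlast (initials st)"
  define c where "c = last (initials st)"
  define m where "m = msize st"
  define T where "T = trail \<sigma>0 I (sizes st)"
  define P where "P = explored \<sigma>0 st"
  have lens: "segment_lengths st = sizes st @ [m]" using adv by (simp add: segment_lengths_def m_def)
  have inv': "well_explored st" "well_positioned st" "within_budget st" "same_outcome st"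
    using inv by (simp_all add: invariant_def)
  note i = inv'(1)[unfolded well_explored_def lens, folded P_def]
  note p = inv'(2)[unfolded well_positioned_def, folded P_def]
  have "initials st \<noteq> []" using i by auto
  then have Ic: "initials st = I @ [c]" by (simp add: I_def c_def)
  have lenI: "length I = length (sizes st)" using i Ic by simp
  have m: "0 < m" using i by simp
  have PT: "P = T @ cycle_prefix \<sigma>0 c m"
    unfolding P_def explored_def lens Ic T_def by (rule trail_snoc[OF lenI])
  obtain m' where m': "m = Suc m'" using m by (cases m) auto
  have cur: "cur st = (\<sigma>0 ^^ m') c" using i adv by (simp add: PT m' cycle_prefix_Suc)
  have s: "\<sigma>0 (cur st) = (\<sigma>0 ^^ m) c" using cur m' by simp
  have closedI: "\<forall>(c, m) \<in> set (zip I (sizes st)). (\<sigma>0 ^^ m) c = c"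
    using i lenI by (simp add: Ic zip_append1)
  have dP: "distinct P" and PO: "set P \<subseteq> \<Omega>" and lP: "length P = found st" using i by auto
  have curP: "cur st \<in> set P" by (simp add: cur PT m' cycle_prefix_Suc)
  have sO: "\<sigma>0 (cur st) \<in> \<Omega>" using curP PO perm0 by (metis permutes_in_image subsetD)
  have "found st \<le> card \<Omega>"
    using dP PO lP finite_points by (metis card_mono distinct_card)
  then have less: "found st < card \<Omega>" using going adv by (simp add: mc_halted_def)
  have q: "queries st \<le> found st - 1 + (jpos st - 1) * (probe_bound + 1)"
    using inv'(3) adv by (simp add: within_budget_def)
  have found_pos: "0 < found st" using curP lP by (cases P) auto
  show ?thesis
  proof (cases "\<sigma>0 (cur st) = c")
    case True
    define st' where "st' = mc_advance \<sigma>0 g \<alpha> st"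
    have f: "initials st' = initials st" "extras st' = extras st" "sizes st' = sizes st @ [m]"
      "founders st' = founders st" "msize st' = 1" "jpos st' = jpos st" "apos st' = 0"
      "sj st' = sj st" "accum st' = accum st" "found st' = found st" "searching st'"
      "queries st' = queries st + 1"
      using True by (simp_all add: st'_def mc_advance_def Let_def Ic m_def)
    have lens': "segment_lengths st' = sizes st @ [m]" using f by (simp add: segment_lengths_def)
    have P': "explored \<sigma>0 st' = P" by (simp add: explored_def lens' P_def lens f)
    have "\<forall>(c, m) \<in> set (zip (initials st') (sizes st')). (\<sigma>0 ^^ m) c = c"
      using closedI lenI True s by (simp add: f Ic)
    then have "well_explored st'"
      unfolding well_explored_def lens' P' using i less by (simp add: f)
    moreover have "well_positioned st'"
      unfolding well_positioned_def P' using p by (simp add: f)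
    moreover have "within_budget st'"
      unfolding within_budget_def f using q \<open>searching st'\<close> by simp
    moreover have "same_outcome st'"
      using inv'(4) by (simp add: same_outcome_def P' f flip: P_def)
    ultimately show ?thesis by (simp add: st'_def invariant_def)
  next
    case False
    define x where "x = \<sigma>0 (cur st)"
    define st' where "st' = mc_advance \<sigma>0 g \<alpha> st"
    have f: "initials st' = initials st" "sizes st' = sizes st"
      "founders st' = founders st" "msize st' = Suc m" "jpos st' = jpos st"
      "extras st' = (if Suc (apos st) = \<alpha> then extras st @ [x] else extras st)"
      "apos st' = (if Suc (apos st) = \<alpha> then 0 else Suc (apos st))"
      "sj st' = sj st" "cur st' = x" "accum st' = accum st + g x" "found st' = Suc (found st)"
      "\<not> searching st'" "queries st' = Suc (queries st)"
      using False adv by (simp_all add: st'_def mc_advance_def Let_def Ic m_def x_def)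
    have lens': "segment_lengths st' = sizes st @ [Suc m]" using f by (simp add: segment_lengths_def)
    have P': "explored \<sigma>0 st' = P @ [x]"
      unfolding explored_def lens' f(1) Ic trail_snoc[OF lenI] cycle_prefix_Suc
      by (simp add: PT T_def x_def s)
    have xT: "x \<notin> set T"
    proof
      assume "x \<in> set T"
      then have "cur st \<in> set T"
        using closed_reflects[of "set T" "cur st"] PO trail_closed[OF lenI closedI]
        unfolding PT T_def[symmetric] x_def by auto
      then show False using dP by (auto simp: PT m' cycle_prefix_Suc cur)
    qed
    have xc: "x \<notin> set (cycle_prefix \<sigma>0 c m)"
    proof
      assume "x \<in> set (cycle_prefix \<sigma>0 c m)"
      then obtain k where k: "k < m" "x = (\<sigma>0 ^^ k) c" by (auto simp: cycle_prefix_def)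
      with False x_def obtain k' where k': "k = Suc k'" by (cases k) auto
      with k have "\<sigma>0 (cur st) = \<sigma>0 ((\<sigma>0 ^^ k') c)" by (simp add: x_def)
      then have "cur st = (\<sigma>0 ^^ k') c" using inj0 by (metis injD)
      moreover have "k' < m'" using k k' m' by simp
      ultimately have "cur st \<in> set (cycle_prefix \<sigma>0 c m')" by (auto simp: cycle_prefix_def)
      then show False using dP by (simp add: PT m' cycle_prefix_Suc cur)
    qed
    have xP: "x \<notin> set P" using xT xc by (simp add: PT)
    have P_ne: "P \<noteq> []" using curP by auto
    have lastP: "last P = cur st" by (simp add: PT m' cycle_prefix_Suc cur)
    have step: "ms_step \<sigma>0 \<sigma>1 (P, jpos st, founders st) = (P @ [x], jpos st, founders st)"
      using xP by (simp add: lastP x_def)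
    have ap: "apos st = (m - 1) mod \<alpha>" using i by (simp add: m_def)
    have ap': "Suc (apos st) = \<alpha> \<longleftrightarrow> \<alpha> dvd m"
      unfolding ap m' using alpha_pos by (auto simp: mod_Suc dvd_eq_mod_eq_0)
    have "apos st' = m mod \<alpha>"
      unfolding f ap m' using alpha_pos by (simp add: mod_Suc)
    moreover have "extras st' = milestones \<sigma>0 \<alpha> (initials st') (segment_lengths st')"
    proof -
      have "extras st = milestones \<sigma>0 \<alpha> I (sizes st) @
              map (\<lambda>i. (\<sigma>0 ^^ i) c) (filter ((dvd) \<alpha>) [1..<m])"
        using i by (simp only: Ic milestones_snoc[OF lenI])
      moreover have "[1..<Suc m] = [1..<m] @ [m]" using m by simp
      ultimately show ?thesis
        unfolding f lens' Ic milestones_snoc[OF lenI] ap' by (simp add: x_def s)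
    qed
    ultimately have "well_explored st'"
      unfolding well_explored_def P' using i xP sO m by (simp add: f lens' flip: x_def)
    moreover have "well_positioned st'"
    proof -
      have "\<sigma>1 ((P @ [x]) ! k) \<in> set (P @ [x])" if "k < jpos st - 1" for k
      proof -
        have "k < length P" using that p lP by linarith
        then show ?thesis using that p by (simp add: nth_append)
      qed
      moreover have "(P @ [x]) ! (jpos st - 1) = P ! (jpos st - 1)"
      proof -
        have "jpos st - 1 < length P" using p lP found_pos by linarith
        then show ?thesis by (simp add: nth_append)
      qed
      ultimately show ?thesis
        unfolding well_positioned_def P' f using p adv by (simp add: f(12))
    qed
    moreover have "within_budget st'"
      unfolding within_budget_def f using q found_pos f(12) by (simp only: if_False)
    moreover have "same_outcome st'"
      using inv'(4) monodromy_solve_step[of P "card \<Omega>" \<sigma>0 \<sigma>1 "jpos st" "founders st"] less lP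
      unfolding same_outcome_def P' f step P_def[symmetric] by simp
    ultimately show ?thesis by (simp add: st'_def invariant_def)
  qed
qed

text \<open>A completed segment returns to its start and has no repetitions, so it is a whole orbit.\<close>

lemma completed_size:
  assumes "invariant st" "(c, m) \<in> set (zip (initials st) (sizes st))"
  shows "m = card (orbit \<sigma>0 c)" "orbit \<sigma>0 c \<subseteq> set (explored \<sigma>0 st)" "c \<in> \<Omega>"
proof -
  from assms(2) obtain k where
    k: "k < length (initials st)" "k < length (sizes st)" "c = initials st ! k" "m = sizes st ! k"
    by (auto simp: set_zip)
  have z: "(c, m) \<in> set (zip (initials st) (segment_lengths st))"
  proof -
    have "k < length (segment_lengths st)" "segment_lengths st ! k = m"
      using k by (simp_all add: segment_lengths_def nth_append)
    then show ?thesis using k by (auto simp: set_zip intro!: exI[of _ k])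
  qed
  have i: "length (initials st) = length (segment_lengths st)" "0 \<notin> set (segment_lengths st)"
    "distinct (explored \<sigma>0 st)" "set (explored \<sigma>0 st) \<subseteq> \<Omega>"
    "\<forall>(c, m) \<in> set (zip (initials st) (sizes st)). (\<sigma>0 ^^ m) c = c"
    using assms(1) unfolding invariant_def well_explored_def by blast+
  have "0 < m" using i(2) z by (metis gr0I set_zip_rightD)
  moreover have "(\<sigma>0 ^^ m) c = c" using i(5) assms(2) by auto
  ultimately have orb: "orbit \<sigma>0 c = set (cycle_prefix \<sigma>0 c m)" by (intro orbit_eq_cycle_prefix)
  have "distinct (cycle_prefix \<sigma>0 c m)"
    using distinct_cycle_prefix[OF _ z] i(3) by (simp add: explored_def)
  then show "m = card (orbit \<sigma>0 c)" by (simp add: orb distinct_card) (simp add: cycle_prefix_def)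
  show sub: "orbit \<sigma>0 c \<subseteq> set (explored \<sigma>0 st)"
    unfolding orb explored_def using in_trailI[OF z] by (auto simp: cycle_prefix_def)
  show "c \<in> \<Omega>" using sub self_in_orbit[of c] i(4) by blast
qed

lemma finite_cycles_on: "finite (cycles_on \<sigma>0 \<Omega>)"
  using finite_points by (simp add: cycles_on_def)

lemma completed_sizes_bound:
  assumes "invariant st" "sizes st \<noteq> []" "length (sizes st) \<le> length (initials st)"
  shows "min (Max (set (sizes st))) \<alpha> \<le> probe_bound"
proof -
  have "Max (set (sizes st)) \<in> set (sizes st)" using assms(2) by simp
  then obtain k where k: "k < length (sizes st)" "sizes st ! k = Max (set (sizes st))"
    by (auto simp: in_set_conv_nth)
  then have "(initials st ! k, Max (set (sizes st))) \<in> set (zip (initials st) (sizes st))"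
    using assms(3) by (auto simp: set_zip intro!: exI[of _ k])
  from completed_size[OF assms(1) this]
  have "Max (set (sizes st)) \<in> card ` cycles_on \<sigma>0 \<Omega>" by (auto simp: cycles_on_def)
  then have "Max (set (sizes st)) \<le> Max (card ` cycles_on \<sigma>0 \<Omega>)" using finite_cycles_on by simp
  then show ?thesis by (simp add: probe_bound_def)
qed

text \<open>All segments are complete here, so membership in the explored set is what inNewCycle decides. On
  success both algorithms append the new point and the founder index; on failure
  MonodromySolve skips the index (\<open>ms_step_skip\<close>). Failure at the last explored position is
  excluded by transitivity, which keeps \<open>jpos\<close> within the explored list.\<close>

lemma invariant_search:
  assumes inv: "invariant st" and srch: "searching st"
  shows "invariant (mc_search \<sigma>0 \<sigma>1 g \<alpha> st)"
proof -
  define I where "I = initials st"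
  define M where "M = sizes st"
  define j where "j = jpos st"
  define P where "P = explored \<sigma>0 st"
  define t where "t = \<sigma>1 (sj st)"
  define K where "K = set I \<union> set (extras st)"
  define st' where "st' = mc_search \<sigma>0 \<sigma>1 g \<alpha> st"
  define B where "B = in_new_cycle \<alpha> K \<sigma>0 M t"
  have lens: "segment_lengths st = M" using srch by (simp add: segment_lengths_def M_def)
  have inv': "well_explored st" "well_positioned st" "within_budget st" "same_outcome st"
    using inv by (simp_all add: invariant_def)
  note i = inv'(1)[unfolded well_explored_def lens, folded P_def I_def M_def]
  note p = inv'(2)[unfolded well_positioned_def, folded P_def I_def j_def]
  have PT: "P = trail \<sigma>0 I M" by (simp add: P_def explored_def lens I_def)
  have lenI: "length I = length M" and M0: "0 \<notin> set M" using i by auto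
  have closedI: "\<forall>(c, m) \<in> set (zip I M). (\<sigma>0 ^^ m) c = c" using i by blast
  have closed: "\<sigma>0 x \<in> set P" if "x \<in> set P" for x
    using trail_closed[OF lenI closedI] that by (simp add: PT)
  have dP: "distinct P" and PO: "set P \<subseteq> \<Omega>" and lP: "length P = found st" using i by auto
  have P_ne: "P \<noteq> []" using i by auto
  then have M_ne: "M \<noteq> []" using lenI by (auto simp: PT trail_def)
  have less: "found st < card \<Omega>" using i srch by simp
  have j: "1 \<le> j" "j \<le> length P" using p lP by auto
  have sj: "sj st = P ! (j - 1)" using p by blast
  have sumM: "sum_list M = length P" using length_trail[OF lenI] by (simp add: PT)
  have t\<Omega>: "t \<in> \<Omega>"
  proof -
    have "P ! (j - 1) \<in> set P" using j by (intro nth_mem) simp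
    then show ?thesis using PO perm1 by (simp add: t_def sj permutes_in_image subset_iff)
  qed
  have K_P: "K \<subseteq> set P"
    using initials_and_milestones_in_trail[OF lenI M0] i by (simp add: K_def PT)
  have new: "fst B \<longleftrightarrow> t \<notin> set P"
  proof
    assume "fst B"
    show "t \<notin> set P"
    proof
      assume "t \<in> set P"
      then have "\<exists>i \<le> min (Max (set M)) \<alpha> - 1. (\<sigma>0 ^^ i) t \<in> K"
        using milestone_ahead[OF lenI closedI _ alpha_pos, of t] i by (simp add: PT K_def)
      with \<open>fst B\<close> show False by (auto simp: B_def in_new_cycle_correct)
    qed
  next
    assume t: "t \<notin> set P"
    have "(\<sigma>0 ^^ k) t \<notin> K" for k
      using closed_reflects_funpow[OF PO closed, of k t] K_P t by blast
    then show "fst B" by (simp add: B_def in_new_cycle_correct)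
  qed
  have Max1: "1 \<le> Max (set M)"
  proof -
    have "Max (set M) \<in> set M" using M_ne by simp
    then show ?thesis using M0 by (metis One_nat_def Suc_leI gr0I)
  qed
  have "snd B \<le> min (Max (set M)) \<alpha> - 1" by (simp only: B_def in_new_cycle_correct)
  moreover have "min (Max (set M)) \<alpha> \<le> probe_bound"
    using completed_sizes_bound[OF inv] M_ne lenI by (simp add: M_def I_def)
  ultimately have sndB: "snd B + 1 \<le> probe_bound" using Max1 alpha_pos by linarith
  have lastP: "\<sigma>0 (last P) \<in> set P" using closed P_ne by simp
  have q: "queries st \<le> length P - 1 + 1 + (j - 1) * (probe_bound + 1)"
    using inv'(3) srch by (simp add: within_budget_def lP j_def)
  have budget: "queries st + 1 + snd B + n \<le> length P + j * (probe_bound + 1)" if "n \<le> 1" for n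
  proof -
    have "j * (probe_bound + 1) = (j - 1) * (probe_bound + 1) + (probe_bound + 1)"
      using j by (cases j) auto
    moreover have "length P - 1 + 1 = length P" using P_ne by (cases P) auto
    ultimately show ?thesis using q sndB that by linarith
  qed
  show ?thesis
  proof (cases "fst B")
    case True
    define N where "N = next_point (I @ [t]) \<sigma>0 M j (sj st)"
    have f: "initials st' = I @ [t]" "sizes st' = M" "founders st' = founders st @ [j]"
      "msize st' = msize st" "jpos st' = Suc j" "extras st' = extras st" "apos st' = apos st"
      "sj st' = fst N" "cur st' = t" "accum st' = accum st + g t" "found st' = Suc (found st)"
      "\<not> searching st'" "queries st' = queries st + 1 + snd B + snd N"
      using True by (simp_all add: st'_def mc_search_def Let_def case_prod_beta N_def
          I_def[symmetric] M_def[symmetric] j_def[symmetric] t_def[symmetric] K_def[symmetric]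
          B_def[symmetric])
    have msize: "msize st = 1" using i srch by simp
    have lens': "segment_lengths st' = M @ [1]" using f msize by (simp add: segment_lengths_def)
    have P': "explored \<sigma>0 st' = P @ [t]"
      unfolding explored_def lens' f trail_snoc[OF lenI] PT by (simp add: cycle_prefix_def)
    have tP: "t \<notin> set P" using new True by simp
    have "extras st' = milestones \<sigma>0 \<alpha> (initials st') (segment_lengths st')"
      unfolding f lens' milestones_snoc[OF lenI] using i by simp
    moreover have "distinct (map (orbit \<sigma>0) (initials st'))"
    proof -
      have "orbit \<sigma>0 t \<noteq> orbit \<sigma>0 c" if "c \<in> set I" for c
      proof
        assume eq: "orbit \<sigma>0 t = orbit \<sigma>0 c"
        from that obtain k where k: "k < length I" "c = I ! k" by (auto simp: in_set_conv_nth)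
        then have "(c, M ! k) \<in> set (zip I M)" using lenI by (auto simp: set_zip)
        then have "orbit \<sigma>0 c \<subseteq> set P"
          using completed_size(2)[OF inv] by (simp add: I_def M_def P_def)
        with eq self_in_orbit[of t] tP show False by blast
      qed
      then show ?thesis using i by (auto simp: f)
    qed
    moreover have "\<forall>(c, m) \<in> set (zip (initials st') (sizes st')). (\<sigma>0 ^^ m) c = c"
    proof -
      have "zip (I @ [t]) M = zip I M" using lenI by (simp add: zip_append1)
      then show ?thesis using closedI by (simp only: f)
    qed
    ultimately have "well_explored st'"
      unfolding well_explored_def P' using i tP t\<Omega> lenI by (simp add: f lens' msize)
    moreover have "well_positioned st'"
    proof -
      have "fst N = (P @ [t]) ! j"
      proof -
        have "(P @ [t]) ! (j - 1) = P ! (j - 1)" using j by (intro nth_append_left) linarith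
        moreover have "trail \<sigma>0 (I @ [t]) (M @ [1]) = P @ [t]" using P' by (simp add: explored_def f lens')
        ultimately show ?thesis
          using trail_Suc(1)[of "I @ [t]" "M @ [1]" j M 1 \<sigma>0] lenI M0 j sumM sj
          by (simp add: N_def)
      qed
      moreover have "\<sigma>1 ((P @ [t]) ! k) \<in> set (P @ [t])" if "k < j" for k
      proof (cases "k = j - 1")
        case True
        moreover have "j - 1 < length P" using j by linarith
        ultimately show ?thesis by (simp add: nth_append_left t_def sj)
      next
        case False
        with that j have "k < j - 1" "k < length P" by auto
        then show ?thesis using p by (simp add: nth_append)
      qed
      moreover have "Max (set (founders st @ [j])) = j"
        using p by (intro Max_eqI) auto
      moreover have "\<forall>k \<in> set (founders st @ [j]). k < Suc j" using p by auto
      moreover have "Suc (length (founders st)) = length I" using p by blast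
      ultimately show ?thesis
        unfolding well_positioned_def P' f using j lP by simp
    qed
    moreover have "snd N \<le> 1"
    proof -
      have "(P @ [t]) ! (j - 1) = P ! (j - 1)" using j by (intro nth_append_left) linarith
      moreover have "trail \<sigma>0 (I @ [t]) (M @ [1]) = P @ [t]" using P' by (simp add: explored_def f lens')
      ultimately show ?thesis
        using trail_Suc(2)[of "I @ [t]" "M @ [1]" j M 1 \<sigma>0] lenI M0 j sumM sj
        by (simp add: N_def)
    qed
    then have "within_budget st'"
      unfolding within_budget_def using budget[of "snd N"] lP by (simp add: f)
    moreover have "same_outcome st'"
      using inv'(4) monodromy_solve_step[of P "card \<Omega>" \<sigma>0 \<sigma>1 j "founders st"] less lP
        ms_step_found[of \<sigma>0 P \<sigma>1 j "founders st"] lastP tP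
      unfolding same_outcome_def P' f P_def[symmetric] j_def[symmetric] t_def sj by simp
    ultimately show ?thesis by (simp add: st'_def invariant_def)
  next
    case False
    define N where "N = next_point I \<sigma>0 M j (sj st)"
    have f: "initials st' = I" "sizes st' = M" "founders st' = founders st"
      "msize st' = msize st" "jpos st' = Suc j" "extras st' = extras st" "apos st' = apos st"
      "sj st' = fst N" "accum st' = accum st" "found st' = found st"
      "searching st'" "queries st' = queries st + 1 + snd B + snd N"
      using False srch by (simp_all add: st'_def mc_search_def Let_def case_prod_beta N_def
          I_def[symmetric] M_def[symmetric] j_def[symmetric] t_def[symmetric] K_def[symmetric]
          B_def[symmetric])
    have lens': "segment_lengths st' = M" using f by (simp add: segment_lengths_def)
    have P': "explored \<sigma>0 st' = P" by (simp add: explored_def f lens' PT)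
    have tP: "t \<in> set P" using new False by simp
    have mapped: "\<sigma>1 (P ! k) \<in> set P" if "k < j" for k
    proof (cases "k = j - 1")
      case True
      then show ?thesis using tP by (simp add: t_def sj)
    next
      case False
      with that have "k < j - 1" by auto
      then show ?thesis using p by blast
    qed
    (* If the last explored point were also tried in vain, the explored set would be closed
       under both permutations. *)
    have j_less: "j < length P"
    proof (rule ccontr)
      assume "\<not> j < length P"
      then have "\<sigma>1 ` set P \<subseteq> set P" using mapped by (auto simp: in_set_conv_nth)
      moreover have "\<sigma>0 ` set P \<subseteq> set P" using closed by blast
      ultimately have "set P = \<Omega>"
        using transitive_invariant_set[OF finite_points perm0 perm1 transitive PO] i by blast
      then show False using less lP dP by (metis distinct_card less_irrefl)
    qed
    have N: "fst N = P ! j" "snd N \<le> 1"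
      using trail_Suc[of I M j M 1 \<sigma>0] lenI M0 j j_less sumM sj by (simp_all add: N_def PT)
    have "well_explored st'"
      unfolding well_explored_def P' lens' using i srch by (simp add: f)
    moreover have "well_positioned st'"
      unfolding well_positioned_def P' f using p mapped j_less lP N f(11) by auto
    moreover have "within_budget st'"
      unfolding within_budget_def using budget[of "snd N"] lP N(2) P_ne by (cases P) (simp_all add: f)
    moreover have "same_outcome st'"
    proof -
      let ?run = "while (\<lambda>(S, j, F). length S < card \<Omega>) (ms_step \<sigma>0 \<sigma>1)"
      have "?run (P, Suc j, founders st) = ?run (P, j, founders st)"
        using monodromy_solve_step[of P "card \<Omega>" \<sigma>0 \<sigma>1 _ "founders st"] less lP
          ms_step_skip[of \<sigma>0 P \<sigma>1 j "founders st"] lastP tP by (simp add: t_def sj)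
      then show ?thesis
        using inv'(4) by (simp add: same_outcome_def P' f flip: P_def j_def)
    qed
    ultimately show ?thesis by (simp add: st'_def invariant_def)
  qed
qed

section \<open>Termination, accumulator and query count\<close>

lemma invariant_step:
  assumes "invariant st" "\<not> mc_halted (card \<Omega>) st"
  shows "invariant (mc_step \<sigma>0 \<sigma>1 g \<alpha> st)"
  using invariant_advance[OF assms(1) _ assms(2)] invariant_search[OF assms(1)]
  by (simp add: mc_step_def)

lemma initials_cycles:
  assumes "invariant st"
  shows "set (initials st) \<subseteq> \<Omega>"
    and "set (map (orbit \<sigma>0) (initials st)) \<subseteq> cycles_on \<sigma>0 \<Omega>"
    and "length (initials st) \<le> card (cycles_on \<sigma>0 \<Omega>)"
proof -
  have i: "length (initials st) = length (segment_lengths st)" "0 \<notin> set (segment_lengths st)"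
    "set (explored \<sigma>0 st) \<subseteq> \<Omega>" "distinct (map (orbit \<sigma>0) (initials st))"
    using assms unfolding invariant_def well_explored_def by blast+
  show sub: "set (initials st) \<subseteq> \<Omega>"
    using initials_and_milestones_in_trail[OF i(1,2), of \<sigma>0 \<alpha>] i(3) by (auto simp: explored_def)
  then show cyc: "set (map (orbit \<sigma>0) (initials st)) \<subseteq> cycles_on \<sigma>0 \<Omega>"
    by (auto simp: cycles_on_def)
  have "length (initials st) = card (set (map (orbit \<sigma>0) (initials st)))"
    using distinct_card[OF i(4)] by simp
  also have "\<dots> \<le> card (cycles_on \<sigma>0 \<Omega>)" by (rule card_mono[OF finite_cycles_on cyc])
  finally show "length (initials st) \<le> card (cycles_on \<sigma>0 \<Omega>)" .
qed

lemma card_cycles_on_le: "card (cycles_on \<sigma>0 \<Omega>) \<le> card \<Omega>"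
  unfolding cycles_on_def by (rule card_image_le[OF finite_points])

lemma counters_bounded:
  assumes "invariant st"
  shows "found st \<le> card \<Omega>" "jpos st \<le> found st" "length (sizes st) \<le> length (initials st)"
    "length (initials st) \<le> card \<Omega>"
proof -
  have i: "distinct (explored \<sigma>0 st)" "set (explored \<sigma>0 st) \<subseteq> \<Omega>"
    "length (explored \<sigma>0 st) = found st" "jpos st \<le> found st"
    "length (initials st) = length (segment_lengths st)"
    using assms unfolding invariant_def well_explored_def well_positioned_def by blast+
  show "found st \<le> card \<Omega>" using i finite_points by (metis card_mono distinct_card)
  show "jpos st \<le> found st" by (rule i)
  show "length (sizes st) \<le> length (initials st)" using i(5) by (simp add: segment_lengths_def)
  show "length (initials st) \<le> card \<Omega>"
    using initials_cycles(3)[OF assms] card_cycles_on_le by linarith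
qed

text \<open>The main loop finds a point or completes a cycle and the search advances \<open>jpos\<close>. None of the three
  counters ever decreases, and the invariant bounds each of them by \<open>d\<close>, whence termination.\<close>

lemma progress:
  "found st + length (sizes st) + jpos st <
   found (mc_step \<sigma>0 \<sigma>1 g \<alpha> st) + length (sizes (mc_step \<sigma>0 \<sigma>1 g \<alpha> st)) +
   jpos (mc_step \<sigma>0 \<sigma>1 g \<alpha> st)"
  by (simp add: mc_step_def mc_advance_def mc_search_def Let_def case_prod_beta)

lemma terminates: "\<exists>st. mc_run \<sigma>0 \<sigma>1 g \<alpha> (card \<Omega>) s1 = Some st"
  unfolding mc_run_def
proof (rule measure_while_option_Some[where P = invariant and
        f = "\<lambda>st. 3 * card \<Omega> + 1 - (found st + length (sizes st) + jpos st)"])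
  fix st assume st: "invariant st" "\<not> mc_halted (card \<Omega>) st"
  let ?st = "mc_step \<sigma>0 \<sigma>1 g \<alpha> st"
  have inv: "invariant ?st" by (rule invariant_step[OF st])
  have "found ?st + length (sizes ?st) + jpos ?st \<le> 3 * card \<Omega>"
    using counters_bounded[OF inv] by linarith
  then show "invariant ?st \<and>
      3 * card \<Omega> + 1 - (found ?st + length (sizes ?st) + jpos ?st)
      < 3 * card \<Omega> + 1 - (found st + length (sizes st) + jpos st)"
    using inv progress[of st] by linarith
qed (rule invariant_init)

text \<open>At the end all points are explored, so MonodromySolve has nothing left to do from the decoded
  state: its founder indices are those of the algorithm.\<close>

lemma result:
  assumes "mc_run \<sigma>0 \<sigma>1 g \<alpha> (card \<Omega>) s1 = Some st"
  shows "accum st = (\<Sum>x\<in>\<Omega>. g x)"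
    and "queries st \<le> card \<Omega> - 1 + largest_founder \<sigma>0 \<sigma>1 (card \<Omega>) s1 * (probe_bound + 1)"
    and "largest_founder \<sigma>0 \<sigma>1 (card \<Omega>) s1 < card \<Omega>"
proof -
  have inv: "invariant st"
    using assms unfolding mc_run_def
    by (rule while_option_rule[where P = invariant, rotated]) (auto intro: invariant_init invariant_step)
  have "\<not> \<not> mc_halted (card \<Omega>) st"
    using assms unfolding mc_run_def by (rule while_option_stop)
  then have halted: "\<not> searching st" "found st = card \<Omega>" by (simp_all add: mc_halted_def)
  have i: "distinct (explored \<sigma>0 st)" "set (explored \<sigma>0 st) \<subseteq> \<Omega>"
    "length (explored \<sigma>0 st) = found st" "accum st = (\<Sum>x\<leftarrow>explored \<sigma>0 st. g x)"
    "1 \<le> jpos st" "jpos st \<le> found st"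
    "jpos st - 1 = (if founders st = [] then 0 else Max (set (founders st)))"
    using inv halted(1) unfolding invariant_def well_explored_def well_positioned_def by blast+
  have all: "set (explored \<sigma>0 st) = \<Omega>"
    using i(1-3) halted(2) finite_points by (metis card_subset_eq distinct_card)
  show "accum st = (\<Sum>x\<in>\<Omega>. g x)"
    unfolding i(4) sum_list_distinct_conv_sum_set[OF i(1)] all ..
  have "monodromy_solve \<sigma>0 \<sigma>1 (card \<Omega>) s1 = (explored \<sigma>0 st, jpos st, founders st)"
    using inv monodromy_solve_done[of "explored \<sigma>0 st" "card \<Omega>"] i(3) halted(2)
    by (simp add: invariant_def same_outcome_def)
  then have lf: "largest_founder \<sigma>0 \<sigma>1 (card \<Omega>) s1 = jpos st - 1"
    unfolding largest_founder_def founder_indices_def Let_def using i(7) by simp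
  then show "queries st \<le> card \<Omega> - 1 + largest_founder \<sigma>0 \<sigma>1 (card \<Omega>) s1 * (probe_bound + 1)"
    using inv halted by (simp add: invariant_def within_budget_def)
  show "largest_founder \<sigma>0 \<sigma>1 (card \<Omega>) s1 < card \<Omega>"
    using lf i(5,6) halted(2) by linarith
qed

lemma visited_invariant:
  assumes "st \<in> mc_visited \<sigma>0 \<sigma>1 g \<alpha> (card \<Omega>) s1"
  shows "invariant st"
proof -
  let ?it = "\<lambda>k. (mc_step \<sigma>0 \<sigma>1 g \<alpha> ^^ k) (mc_init g s1)"
  have "(\<forall>i<k. \<not> mc_halted (card \<Omega>) (?it i)) \<Longrightarrow> invariant (?it k)" for k
    by (induction k) (simp_all add: invariant_init invariant_step)
  then show ?thesis using assms by (auto simp: mc_visited_def)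
qed

lemma visited_nonempty: "mc_init g s1 \<in> mc_visited \<sigma>0 \<sigma>1 g \<alpha> (card \<Omega>) s1"
  unfolding mc_visited_def by (rule CollectI, rule exI[of _ 0]) simp

lemma finite_visited: "finite (mc_visited \<sigma>0 \<sigma>1 g \<alpha> (card \<Omega>) s1)"
proof -
  let ?it = "\<lambda>k. (mc_step \<sigma>0 \<sigma>1 g \<alpha> ^^ k) (mc_init g s1)"
  from terminates obtain n where n: "mc_halted (card \<Omega>) (?it n)"
    by (auto simp: mc_run_def while_option_def split: if_splits)
  have "mc_visited \<sigma>0 \<sigma>1 g \<alpha> (card \<Omega>) s1 \<subseteq> ?it ` {..n}"
  proof
    fix st assume "st \<in> mc_visited \<sigma>0 \<sigma>1 g \<alpha> (card \<Omega>) s1"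
    then obtain k where k: "st = ?it k" "\<forall>i<k. \<not> mc_halted (card \<Omega>) (?it i)"
      by (auto simp: mc_visited_def)
    then have "k \<le> n" using n by (metis not_le)
    with k(1) show "st \<in> ?it ` {..n}" by blast
  qed
  then show ?thesis by (rule finite_subset) simp
qed

section \<open>Storage and time of a single run\<close>

lemma segment_length_le:
  assumes "invariant st" "k < length (initials st)"
  shows "segment_lengths st ! k \<le> card (orbit \<sigma>0 (initials st ! k))"
proof -
  let ?c = "initials st ! k" and ?m = "segment_lengths st ! k"
  have i: "length (initials st) = length (segment_lengths st)" "distinct (explored \<sigma>0 st)"
    using assms(1) unfolding invariant_def well_explored_def by blast+
  have "(?c, ?m) \<in> set (zip (initials st) (segment_lengths st))"
    using assms(2) i(1) by (auto simp: set_zip)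
  then have "distinct (cycle_prefix \<sigma>0 ?c ?m)"
    using distinct_cycle_prefix i(2) unfolding explored_def by metis
  then have "?m = card (set (cycle_prefix \<sigma>0 ?c ?m))"
    by (simp add: distinct_card) (simp add: cycle_prefix_def)
  also have "\<dots> \<le> card (orbit \<sigma>0 ?c)"
  proof (rule card_mono)
    show "finite (orbit \<sigma>0 ?c)" by (rule finite_orbit[OF self_in_orbit])
    show "set (cycle_prefix \<sigma>0 ?c ?m) \<subseteq> orbit \<sigma>0 ?c"
      using funpow_in_orbit[OF self_in_orbit] by (auto simp: cycle_prefix_def)
  qed
  finally show ?thesis .
qed

text \<open>Bounds the stored points of a possibly partial segment by the number that its full cycle is
  entitled to.\<close>

lemma Suc_div_le_ceiling:
  assumes "0 < m" "m \<le> c"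
  shows "Suc ((m - 1) div \<alpha>) \<le> nat \<lceil>real c / real \<alpha>\<rceil>"
proof -
  have "(m - 1) div \<alpha> * \<alpha> \<le> m - 1" by simp
  then have "(m - 1) div \<alpha> * \<alpha> < c" using assms by linarith
  then have "real ((m - 1) div \<alpha>) * real \<alpha> < real c"
    by (metis of_nat_less_iff of_nat_mult)
  then have "real ((m - 1) div \<alpha>) < real c / real \<alpha>"
    using alpha_pos by (simp add: pos_less_divide_eq)
  then have "int ((m - 1) div \<alpha>) < \<lceil>real c / real \<alpha>\<rceil>"
    by (simp add: less_ceiling_iff)
  then show ?thesis by linarith
qed

lemma points_bound:
  assumes inv: "invariant st"
  shows "stored_points st \<le> (\<Sum>c\<in>cycles_on \<sigma>0 \<Omega>. nat \<lceil>real (card c) / real \<alpha>\<rceil>) + 4"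
proof -
  let ?h = "\<lambda>c. nat \<lceil>real (card c) / real \<alpha>\<rceil>"
  have i: "length (initials st) = length (segment_lengths st)" "0 \<notin> set (segment_lengths st)"
    "extras st = milestones \<sigma>0 \<alpha> (initials st) (segment_lengths st)"
    "distinct (map (orbit \<sigma>0) (initials st))"
    using inv unfolding invariant_def well_explored_def by blast+
  have "length (initials st) + length (extras st) = (\<Sum>m\<leftarrow>segment_lengths st. Suc ((m - 1) div \<alpha>))"
    using length_milestones[OF i(1,2)] i(3) by simp
  also have "\<dots> \<le> sum_list (map ?h (map (orbit \<sigma>0) (initials st)))"
  proof (rule sum_list_mono2)
    show "length (map (\<lambda>m. Suc ((m - 1) div \<alpha>)) (segment_lengths st)) =
          length (map ?h (map (orbit \<sigma>0) (initials st)))"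
      using i(1) by simp
    fix k
    show "k < length (map (\<lambda>m. Suc ((m - 1) div \<alpha>)) (segment_lengths st)) \<longrightarrow>
          map (\<lambda>m. Suc ((m - 1) div \<alpha>)) (segment_lengths st) ! k \<le>
          map ?h (map (orbit \<sigma>0) (initials st)) ! k"
    proof
      assume "k < length (map (\<lambda>m. Suc ((m - 1) div \<alpha>)) (segment_lengths st))"
      then have k: "k < length (initials st)" "k < length (segment_lengths st)" using i(1) by simp_all
      have "0 < segment_lengths st ! k" using k i(2) by (metis gr0I nth_mem)
      then show "map (\<lambda>m. Suc ((m - 1) div \<alpha>)) (segment_lengths st) ! k \<le>
          map ?h (map (orbit \<sigma>0) (initials st)) ! k"
        using Suc_div_le_ceiling[OF _ segment_length_le[OF inv k(1)]] k by simp
    qed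
  qed
  also have "\<dots> = sum ?h (set (map (orbit \<sigma>0) (initials st)))"
    by (rule sum_list_distinct_conv_sum_set[OF i(4)])
  also have "\<dots> \<le> sum ?h (cycles_on \<sigma>0 \<Omega>)"
    by (rule sum_mono2[OF finite_cycles_on initials_cycles(2)[OF inv]]) simp
  finally show ?thesis by (simp add: stored_points_def mc_points_def)
qed

lemma ints_bound:
  assumes inv: "invariant st"
  shows "stored_ints st \<le> 2 * card (cycles_on \<sigma>0 \<Omega>) - 1 + 10"
    and "\<forall>i \<in> set (mc_ints st). i \<le> card \<Omega>"
proof -
  have i: "length (initials st) = length (segment_lengths st)"
    "length (explored \<sigma>0 st) = found st" "apos st = (msize st - 1) mod \<alpha>"
    "if searching st then msize st = 1 \<and> found st < card \<Omega> else cur st = last (explored \<sigma>0 st)"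
    "1 \<le> jpos st" "jpos st \<le> found st"
    "Suc (length (founders st)) = length (initials st)" "\<forall>f \<in> set (founders st). f < jpos st"
    using inv unfolding invariant_def well_explored_def well_positioned_def by blast+
  note b = counters_bounded[OF inv]
  show "stored_ints st \<le> 2 * card (cycles_on \<sigma>0 \<Omega>) - 1 + 10"
    using b(3) i(7) initials_cycles(3)[OF inv] by (simp add: stored_ints_def mc_ints_def)
  have "found st = sum_list (segment_lengths st)"
    using i(2) length_trail[OF i(1)] by (simp add: explored_def)
  then have seg: "m \<le> found st" if "m \<in> set (segment_lengths st)" for m
    using member_le_sum_list[OF that] by simp
  have ms: "msize st \<le> found st"
  proof (cases "searching st")
    case True
    then show ?thesis using i(4,5,6) by simp
  next
    case False
    then show ?thesis using seg by (simp add: segment_lengths_def)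
  qed
  have "apos st \<le> msize st - 1" unfolding i(3) by (rule mod_less_eq_dividend)
  then show "\<forall>i \<in> set (mc_ints st). i \<le> card \<Omega>"
    using seg ms i(6,8) b(1) unfolding mc_ints_def segment_lengths_def by fastforce
qed

lemma sum_card_cycles: "(\<Sum>c\<in>cycles_on \<sigma>0 \<Omega>. card c) = card \<Omega>"
proof -
  have "pairwise disjnt (cycles_on \<sigma>0 \<Omega>)"
  proof (rule pairwiseI)
    fix C D assume "C \<in> cycles_on \<sigma>0 \<Omega>" "D \<in> cycles_on \<sigma>0 \<Omega>" "C \<noteq> D"
    then show "disjnt C D"
      using orbit_cyclic_eq3[OF cyclic_on_orbit[OF perm0 finite_points]]
      unfolding disjnt_def cycles_on_def by (metis disjoint_iff imageE)
  qed
  moreover have "\<Union>(cycles_on \<sigma>0 \<Omega>) = \<Omega>"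
    using permutes_orbit_subset[OF perm0] self_in_orbit by (auto simp: cycles_on_def)
  moreover have "finite C" if "C \<in> cycles_on \<sigma>0 \<Omega>" for C
    using that finite_orbit[OF self_in_orbit] by (auto simp: cycles_on_def)
  ultimately show ?thesis using card_Union_disjoint by metis
qed

lemma cycle_length_le: "Max (card ` cycles_on \<sigma>0 \<Omega>) \<le> card \<Omega>"
proof -
  have "card c \<le> card \<Omega>" if "c \<in> cycles_on \<sigma>0 \<Omega>" for c
    using that permutes_orbit_subset[OF perm0] card_mono[OF finite_points] by (auto simp: cycles_on_def)
  moreover have "cycles_on \<sigma>0 \<Omega> \<noteq> {}" using start by (auto simp: cycles_on_def)
  ultimately show ?thesis using finite_cycles_on by simp
qed

text \<open>A bound for every input: there are fewer than \<open>d\<close> search steps, each of cost at most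
  \<open>min d \<alpha> + 1\<close>.\<close>

lemma time_bound: "mc_time \<sigma>0 \<sigma>1 g \<alpha> (card \<Omega>) s1 \<le> 3 * card \<Omega> * min (card \<Omega>) \<alpha>"
proof -
  from terminates obtain st where st: "mc_run \<sigma>0 \<sigma>1 g \<alpha> (card \<Omega>) s1 = Some st" by blast
  let ?d = "card \<Omega>" and ?m = "min (card \<Omega>) \<alpha>" and ?j = "largest_founder \<sigma>0 \<sigma>1 (card \<Omega>) s1"
  have m: "1 \<le> ?m" using start finite_points alpha_pos by (auto simp: Suc_le_eq card_gt_0_iff)
  have "queries st \<le> ?d - 1 + ?j * (probe_bound + 1)" by (rule result(2)[OF st])
  also have "\<dots> \<le> ?d * ?m + ?d * (?m + ?m)"
  proof (intro add_mono mult_mono)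
    show "?d - 1 \<le> ?d * ?m" using m by (metis diff_le_self le_trans mult.right_neutral mult_le_mono2)
    show "?j \<le> ?d" using result(3)[OF st] by simp
    show "probe_bound \<le> ?m" using cycle_length_le by (auto simp: probe_bound_def)
  qed (use m in auto)
  also have "\<dots> = 3 * ?d * ?m" by (simp add: algebra_simps)
  finally show ?thesis by (simp add: mc_time_def st)
qed

lemma space_bound:
  assumes "0 \<le> \<rho>R" "0 \<le> \<rho>N"
  shows "mc_space \<rho>R \<rho>N n \<sigma>0 \<sigma>1 g \<alpha> (card \<Omega>) s1 \<le>
     2 * real n * \<rho>R * (real (card \<Omega>) / real \<alpha> + real (card (cycles_on \<sigma>0 \<Omega>)) + 4) +
     \<rho>N * (2 * real (card (cycles_on \<sigma>0 \<Omega>)) + 10)"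
proof -
  let ?C = "cycles_on \<sigma>0 \<Omega>"
  have ceil: "real (nat \<lceil>real (card c) / real \<alpha>\<rceil>) \<le> real (card c) / real \<alpha> + 1" for c :: "'p set"
    using of_int_ceiling_le_add_one[of "real (card c) / real \<alpha>"]
    by (simp add: of_nat_nat)
  have "real (\<Sum>c\<in>?C. nat \<lceil>real (card c) / real \<alpha>\<rceil>) \<le> (\<Sum>c\<in>?C. real (card c) / real \<alpha> + 1)"
    unfolding of_nat_sum by (rule sum_mono) (rule ceil)
  also have "\<dots> = real (\<Sum>c\<in>?C. card c) / real \<alpha> + real (card ?C)"
    by (simp add: sum.distrib sum_divide_distrib)
  finally have sum: "real (\<Sum>c\<in>?C. nat \<lceil>real (card c) / real \<alpha>\<rceil>) \<le>
      real (card \<Omega>) / real \<alpha> + real (card ?C)" by (simp only: sum_card_cycles)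
  have "state_bits \<rho>R \<rho>N n st \<le>
     2 * real n * \<rho>R * (real (card \<Omega>) / real \<alpha> + real (card ?C) + 4) + \<rho>N * (2 * real (card ?C) + 10)"
    if "st \<in> mc_visited \<sigma>0 \<sigma>1 g \<alpha> (card \<Omega>) s1" for st
  proof -
    note inv = visited_invariant[OF that]
    have "real (stored_points st) \<le> real ((\<Sum>c\<in>?C. nat \<lceil>real (card c) / real \<alpha>\<rceil>) + 4)"
      using points_bound[OF inv] by (rule of_nat_mono)
    then have "real (stored_points st) \<le> real (card \<Omega>) / real \<alpha> + real (card ?C) + 4"
      using sum by simp
    moreover have "real (stored_ints st) \<le> 2 * real (card ?C) + 10"
      using ints_bound(1)[OF inv] by linarith
    ultimately show ?thesis
      unfolding state_bits_def using assms by (intro add_mono mult_left_mono) auto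
  qed
  then show ?thesis
    unfolding mc_space_def using finite_visited visited_nonempty by (subst Max_le_iff) auto
qed

end

section \<open>Random pairs generate a transitive group with probability at least one half\<close>

lemma fact_mult_fact_le: "fact (Suc a) * fact (Suc b) \<le> (fact (Suc (a + b)) :: nat)"
proof (induction a)
  case (Suc a)
  have "fact (Suc (Suc a)) = Suc (Suc a) * (fact (Suc a) :: nat)" by (subst fact_Suc) simp
  then have "fact (Suc (Suc a)) * fact (Suc b) = Suc (Suc a) * (fact (Suc a) * fact (Suc b) :: nat)"
    by (simp only: mult.assoc)
  also have "\<dots> \<le> Suc (Suc (a + b)) * fact (Suc (a + b))"
    using Suc.IH by (intro mult_le_mono) auto
  also have "\<dots> = fact (Suc (Suc a + b))" by simp
  finally show ?case .
qed simp

text \<open>A permutation that preserves \<open>A\<close> is determined by its restrictions to \<open>A\<close> and to the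
  complement.\<close>

lemma card_stabilizer_le:
  assumes "finite \<Omega>" "A \<subseteq> \<Omega>"
  shows "card {\<pi>. \<pi> permutes \<Omega> \<and> \<pi> ` A = A} \<le> fact (card A) * fact (card (\<Omega> - A))"
proof -
  let ?res = "\<lambda>B \<pi> x. if x \<in> B then \<pi> x else x"
  let ?S = "{\<pi>. \<pi> permutes \<Omega> \<and> \<pi> ` A = A}"
  let ?T = "{\<pi>. \<pi> permutes A} \<times> {\<pi>. \<pi> permutes \<Omega> - A}"
  have fin: "finite A" "finite (\<Omega> - A)" using assms finite_subset by auto
  have res: "?res B \<pi> permutes B" if "\<pi> permutes \<Omega>" "\<pi> ` B = B" for \<pi> B
  proof (rule bij_imp_permutes)
    have "bij_betw \<pi> B B"
      using that permutes_inj[OF that(1)] by (auto simp: bij_betw_def intro: inj_on_subset)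
    then show "bij_betw (?res B \<pi>) B B" by (rule bij_betw_cong[THEN iffD1, rotated]) simp
  qed simp
  have "inj_on (\<lambda>\<pi>. (?res A \<pi>, ?res (\<Omega> - A) \<pi>)) ?S"
  proof (rule inj_onI)
    fix p q assume p: "p \<in> ?S" and q: "q \<in> ?S"
      and eq: "(?res A p, ?res (\<Omega> - A) p) = (?res A q, ?res (\<Omega> - A) q)"
    show "p = q"
    proof
      fix x
      have e: "?res A p x = ?res A q x" "?res (\<Omega> - A) p x = ?res (\<Omega> - A) q x"
        using eq by (auto dest: fun_cong[of _ _ x])
      show "p x = q x"
      proof (cases "x \<in> \<Omega>")
        case True
        then show ?thesis using e by (cases "x \<in> A") auto
      next
        case False
        then show ?thesis using p q permutes_not_in[of p \<Omega> x] permutes_not_in[of q \<Omega> x] by simp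
      qed
    qed
  qed
  moreover have "(\<lambda>\<pi>. (?res A \<pi>, ?res (\<Omega> - A) \<pi>)) ` ?S \<subseteq> ?T"
  proof
    fix y assume "y \<in> (\<lambda>\<pi>. (?res A \<pi>, ?res (\<Omega> - A) \<pi>)) ` ?S"
    then obtain \<pi> where \<pi>: "\<pi> permutes \<Omega>" "\<pi> ` A = A" "y = (?res A \<pi>, ?res (\<Omega> - A) \<pi>)" by blast
    have "\<pi> ` (\<Omega> - A) = \<Omega> - A"
      using image_set_diff[OF permutes_inj[OF \<pi>(1)]] permutes_image[OF \<pi>(1)] \<pi>(2) by simp
    then show "y \<in> ?T"
      unfolding \<pi>(3) using res[OF \<pi>(1,2)] res[OF \<pi>(1)]
      by (simp only: mem_Sigma_iff mem_Collect_eq)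
  qed
  moreover have "finite ?T" using fin by (intro finite_cartesian_product finite_permutations)
  ultimately have "card ?S \<le> card ?T" by (rule card_inj_on_le)
  also have "card ?T = fact (card A) * fact (card (\<Omega> - A))"
    using card_permutations[OF refl fin(1)] card_permutations[OF refl fin(2)]
    by (simp add: card_cartesian_product)
  finally show ?thesis .
qed

text \<open>The group orbit of some point is a proper invariant set, and so is its complement; one of the two
  contains \<open>s\<close>. Fixing the base point \<open>s\<close> counts each such partition once instead of twice, which
  is what brings the union bound below \<open>1/2\<close>.\<close>

lemma nontransitive_invariant_set:
  assumes "finite \<Omega>" "s \<in> \<Omega>" "\<sigma>0 permutes \<Omega>" "\<sigma>1 permutes \<Omega>" "\<not> generates_transitive \<Omega> \<sigma>0 \<sigma>1"
  shows "\<exists>A. s \<in> A \<and> A \<subset> \<Omega> \<and> \<sigma>0 ` A = A \<and> \<sigma>1 ` A = A"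
proof -
  let ?G = "generate (perm_group \<Omega>) {\<sigma>0, \<sigma>1}"
  from assms(5) obtain x y where xy: "x \<in> \<Omega>" "y \<in> \<Omega>" "\<And>h. h \<in> ?G \<Longrightarrow> h x \<noteq> y"
    unfolding generates_transitive_def by blast
  define A where "A = (\<lambda>h. h x) ` ?G"
  have "id \<in> ?G" using generate.one[of "perm_group \<Omega>" "{\<sigma>0, \<sigma>1}"] by (simp add: perm_group_def)
  then have xA: "x \<in> A" unfolding A_def by (rule rev_image_eqI) simp
  have A\<Omega>: "A \<subseteq> \<Omega>"
  proof
    fix z assume "z \<in> A"
    then obtain h where "h \<in> ?G" "z = h x" by (auto simp: A_def)
    then show "z \<in> \<Omega>"
      using generate_preserves[OF assms(3,4) permutes_image[OF assms(3)] permutes_image[OF assms(4)]]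
        xy(1) by blast
  qed
  have yA: "y \<notin> A" using xy(3) by (auto simp: A_def)
  have inv: "\<sigma> ` A = A" if \<sigma>: "\<sigma> \<in> {\<sigma>0, \<sigma>1}" for \<sigma>
  proof (rule endo_inj_surj)
    show "finite A" using A\<Omega> assms(1) finite_subset by blast
    show "inj_on \<sigma> A" using \<sigma> assms(3,4) by (auto intro: inj_on_subset dest: permutes_inj)
    show "\<sigma> ` A \<subseteq> A"
    proof
      fix z assume "z \<in> \<sigma> ` A"
      then obtain h where h: "h \<in> ?G" "z = \<sigma> (h x)" by (auto simp: A_def)
      have "\<sigma> \<otimes>\<^bsub>perm_group \<Omega>\<^esub> h \<in> ?G" by (rule generate.eng[OF generate.incl[OF \<sigma>] h(1)])
      then have "\<sigma> \<circ> h \<in> ?G" by (simp add: perm_group_def)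
      then show "z \<in> A" unfolding A_def by (rule rev_image_eqI) (simp add: h(2))
    qed
  qed
  show ?thesis
  proof (cases "s \<in> A")
    case True
    then show ?thesis using A\<Omega> yA xy(2) inv[of \<sigma>0] inv[of \<sigma>1] by (intro exI[of _ A]) auto
  next
    case False
    have "\<sigma> ` (\<Omega> - A) = \<Omega> - A" if "\<sigma> \<in> {\<sigma>0, \<sigma>1}" for \<sigma>
    proof -
      have "\<sigma> permutes \<Omega>" using that assms(3,4) by auto
      then show ?thesis
        using inv[OF that] image_set_diff[OF permutes_inj, of \<sigma> \<Omega> \<Omega> A] permutes_image[of \<sigma> \<Omega>] by simp
    qed
    from this[of \<sigma>0] this[of \<sigma>1] show ?thesis
      using False assms(2) xA A\<Omega> by (intro exI[of _ "\<Omega> - A"]) auto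
  qed
qed

lemma sum_over_proper_subsets:
  fixes f :: "nat \<Rightarrow> nat"
  assumes "finite X"
  shows "(\<Sum>B | B \<subset> X. f (card B)) = (\<Sum>k<card X. (card X choose k) * f k)"
proof -
  have fin: "finite {B. B \<subset> X}" using assms by (rule finite_subset[rotated, OF finite_Pow_iff[THEN iffD2]]) auto
  have "(\<Sum>B | B \<subset> X. f (card B)) =
        (\<Sum>k\<in>{..<card X}. \<Sum>B\<in>{B \<in> {B. B \<subset> X}. card B = k}. f (card B))"
    using assms psubset_card_mono by (intro sum.group[symmetric] fin) auto
  also have "\<dots> = (\<Sum>k<card X. (card X choose k) * f k)"
  proof (rule sum.cong[OF refl])
    fix k assume k: "k \<in> {..<card X}"
    have "{B \<in> {B. B \<subset> X}. card B = k} = {B. B \<subseteq> X \<and> card B = k}"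
      using k by auto
    then show "(\<Sum>B\<in>{B \<in> {B. B \<subset> X}. card B = k}. f (card B)) = (card X choose k) * f k"
      by (simp add: n_subsets[OF assms])
  qed
  finally show ?thesis .
qed

text \<open>The union bound for \<open>N + 1\<close> points, with the sets containing the base point grouped by their size
  \<open>k + 1\<close>. One factor \<open>(k + 1)! (N - k)!\<close> cancels the binomial coefficient and leaves
  \<open>(k + 1) N!\<close>; the other one is at most \<open>N!\<close>. It remains to add up \<open>k + 1\<close> for \<open>k < N\<close>.\<close>

lemma sum_stabilizer_pairs_le:
  "2 * (\<Sum>k<N. (N choose k) * (fact (Suc k) * fact (N - k))\<^sup>2) \<le> (fact (Suc N) :: nat)\<^sup>2"
proof -
  have "(\<Sum>k<N. (N choose k) * (fact (Suc k) * fact (N - k))\<^sup>2) \<le> (\<Sum>k<N. Suc k * (fact N)\<^sup>2)"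
  proof (rule sum_mono)
    fix k assume "k \<in> {..<N}"
    then have k: "k < N" by simp
    have "(N choose k) * (fact (Suc k) * fact (N - k)) = Suc k * (fact k * fact (N - k) * (N choose k))"
      by (simp add: algebra_simps)
    also have "\<dots> = Suc k * fact N" using binomial_fact_lemma[of k N] k by simp
    finally have 1: "(N choose k) * (fact (Suc k) * fact (N - k)) = Suc k * fact N" .
    have 2: "fact (Suc k) * fact (N - k) \<le> (fact N :: nat)"
      using fact_mult_fact_le[of k "N - Suc k"] k by (simp del: fact_Suc add: Suc_diff_Suc)
    have "(N choose k) * (fact (Suc k) * fact (N - k))\<^sup>2 =
          (N choose k) * (fact (Suc k) * fact (N - k)) * (fact (Suc k) * fact (N - k))"
      by (simp only: power2_eq_square mult.assoc)
    also have "\<dots> \<le> Suc k * fact N * fact N" unfolding 1 using 2 by (rule mult_le_mono2)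
    finally show "(N choose k) * (fact (Suc k) * fact (N - k))\<^sup>2 \<le> Suc k * (fact N)\<^sup>2"
      by (simp only: power2_eq_square mult.assoc)
  qed
  also have "\<dots> = (\<Sum>k<N. Suc k) * (fact N)\<^sup>2" by (simp only: sum_distrib_right)
  finally have "2 * (\<Sum>k<N. (N choose k) * (fact (Suc k) * fact (N - k))\<^sup>2)
      \<le> (2 * (\<Sum>k<N. Suc k)) * (fact N)\<^sup>2" by simp
  also have "2 * (\<Sum>k<N. Suc k) = N * Suc N" by (induction N) auto
  also have "N * Suc N * (fact N)\<^sup>2 \<le> Suc N * Suc N * (fact N)\<^sup>2"
    by (intro mult_le_mono) auto
  also have "\<dots> = (fact (Suc N))\<^sup>2" by (simp add: power2_eq_square algebra_simps)
  finally show ?thesis .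
qed

definition transitive_pairs :: "'p set \<Rightarrow> (('p \<Rightarrow> 'p) \<times> ('p \<Rightarrow> 'p)) set" where
  "transitive_pairs \<Omega> =
     {(\<sigma>0, \<sigma>1). \<sigma>0 permutes \<Omega> \<and> \<sigma>1 permutes \<Omega> \<and> generates_transitive \<Omega> \<sigma>0 \<sigma>1}"

text \<open>Union bound over the proper subsets that contain \<open>s\<close>, one of which is preserved by every pair that
  does not generate a transitive group.\<close>

lemma card_transitive_pairs:
  assumes fin: "finite \<Omega>" and s: "s \<in> \<Omega>"
  shows "(fact (card \<Omega>))\<^sup>2 \<le> 2 * card (transitive_pairs \<Omega>)"
proof -
  let ?P = "{\<pi>. \<pi> permutes \<Omega>}"
  let ?stab = "\<lambda>A. {\<pi>. \<pi> permutes \<Omega> \<and> \<pi> ` A = A}"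
  let ?F = "{A. s \<in> A \<and> A \<subset> \<Omega>}"
  define N where "N = card (\<Omega> - {s})"
  have d: "card \<Omega> = Suc N" using fin s by (simp add: N_def card_Suc_Diff1 del: card_Diff_insert)
  have finF: "finite ?F" using fin by (rule finite_subset[rotated, OF finite_Pow_iff[THEN iffD2]]) auto
  have finP: "finite ?P" by (rule finite_permutations[OF fin])
  have "?P \<times> ?P \<subseteq> transitive_pairs \<Omega> \<union> (\<Union>A\<in>?F. ?stab A \<times> ?stab A)"
  proof
    fix z assume "z \<in> ?P \<times> ?P"
    then obtain a b where z: "z = (a, b)" "a permutes \<Omega>" "b permutes \<Omega>" by auto
    show "z \<in> transitive_pairs \<Omega> \<union> (\<Union>A\<in>?F. ?stab A \<times> ?stab A)"
    proof (cases "generates_transitive \<Omega> a b")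
      case True
      then show ?thesis using z by (simp add: transitive_pairs_def)
    next
      case False
      from nontransitive_invariant_set[OF fin s z(2,3) this] obtain A where
        "A \<in> ?F" "a ` A = A" "b ` A = A" by blast
      then show ?thesis using z by blast
    qed
  qed
  moreover have "finite (transitive_pairs \<Omega> \<union> (\<Union>A\<in>?F. ?stab A \<times> ?stab A))"
    by (rule finite_subset[of _ "?P \<times> ?P"]) (use finP in \<open>auto simp: transitive_pairs_def\<close>)
  ultimately have "card (?P \<times> ?P) \<le> card (transitive_pairs \<Omega> \<union> (\<Union>A\<in>?F. ?stab A \<times> ?stab A))"
    by (intro card_mono)
  also have "\<dots> \<le> card (transitive_pairs \<Omega>) + card (\<Union>A\<in>?F. ?stab A \<times> ?stab A)"
    by (rule card_Un_le)
  also have "card (\<Union>A\<in>?F. ?stab A \<times> ?stab A) \<le> (\<Sum>A\<in>?F. card (?stab A \<times> ?stab A))"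
    by (rule card_UN_le[OF finF])
  also have "\<dots> \<le> (\<Sum>A\<in>?F. (fact (card A) * fact (card \<Omega> - card A))\<^sup>2)"
  proof (rule sum_mono)
    fix A assume "A \<in> ?F"
    then have A: "A \<subseteq> \<Omega>" by blast
    then have "card (\<Omega> - A) = card \<Omega> - card A" using fin by (simp add: card_Diff_subset finite_subset)
    then have "card (?stab A) \<le> fact (card A) * fact (card \<Omega> - card A)"
      using card_stabilizer_le[OF fin A] by simp
    then show "card (?stab A \<times> ?stab A) \<le> (fact (card A) * fact (card \<Omega> - card A))\<^sup>2"
      by (simp only: card_cartesian_product power2_eq_square mult_le_mono)
  qed
  also have "\<dots> = (\<Sum>B | B \<subset> \<Omega> - {s}. (fact (Suc (card B)) * fact (N - card B))\<^sup>2)"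
  proof (rule sum.reindex_bij_witness[of _ "insert s" "\<lambda>A. A - {s}"])
    fix A assume "A \<in> ?F"
    then have A: "s \<in> A" "A \<subseteq> \<Omega>" "A \<noteq> \<Omega>" by auto
    then have "card A = Suc (card (A - {s}))"
      using fin by (metis card_Suc_Diff1 finite_subset)
    then show "(fact (Suc (card (A - {s}))) * fact (N - card (A - {s})))\<^sup>2 =
               (fact (card A) * fact (card \<Omega> - card A))\<^sup>2" by (simp add: d)
    show "insert s (A - {s}) = A" using A by blast
    show "A - {s} \<in> {B. B \<subset> \<Omega> - {s}}" using A by blast
  next
    fix B assume "B \<in> {B. B \<subset> \<Omega> - {s}}"
    then show "insert s B - {s} = B" "insert s B \<in> ?F" using s by blast+
  qed
  also have "\<dots> = (\<Sum>k<N. (N choose k) * (fact (Suc k) * fact (N - k))\<^sup>2)"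
    unfolding N_def using fin
    by (rule sum_over_proper_subsets[OF finite_Diff, of \<Omega> "\<lambda>k. (fact (Suc k) * fact (card (\<Omega> - {s}) - k))\<^sup>2" "{s}"])
  finally have "card (?P \<times> ?P) \<le>
      card (transitive_pairs \<Omega>) + (\<Sum>k<N. (N choose k) * (fact (Suc k) * fact (N - k))\<^sup>2)" by simp
  moreover have "card (?P \<times> ?P) = (fact (card \<Omega>))\<^sup>2"
    using card_permutations[OF refl fin] by (simp add: card_cartesian_product power2_eq_square)
  ultimately show ?thesis using sum_stabilizer_pairs_le[of N] by (simp add: d del: fact_Suc)
qed

section \<open>The expected number of cycles\<close>

text \<open>The hypothesis says that \<open>f\<close> factors through \<open>g\<close> on \<open>A\<close>.\<close>

lemma card_image_le_of_factor:
  assumes "finite A" "\<And>x y. x \<in> A \<Longrightarrow> y \<in> A \<Longrightarrow> g x = g y \<Longrightarrow> f x = f y"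
  shows "card (f ` A) \<le> card (g ` A)"
proof -
  have "f x = (f \<circ> inv_into A g) (g x)" if "x \<in> A" for x
    using that assms(2)[of x "inv_into A g (g x)"]
    by (simp add: f_inv_into_f inv_into_into)
  then have "f ` A = (f \<circ> inv_into A g) ` (g ` A)" by (auto simp: image_image intro!: image_cong)
  also have "card \<dots> \<le> card (g ` A)" using assms(1) by (intro card_image_le) simp
  finally show ?thesis .
qed

lemma orbit_mem_eq:
  assumes "finite \<Omega>" "\<pi> permutes \<Omega>" "y \<in> orbit \<pi> x"
  shows "orbit \<pi> y = orbit \<pi> x"
  using orbit_cyclic_eq3[OF cyclic_on_orbit[OF assms(2,1)] assms(3)] .

text \<open>Composing with the transposition inserts the new point \<open>a\<close> into the cycle of \<open>b\<close>, right before
  \<open>b\<close>, and leaves the cycles otherwise alone. It is enough that points in one cycle of \<open>p\<close> stay in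
  one cycle and that \<open>a\<close> joins the cycle of \<open>b\<close>.\<close>

lemma card_cycles_transpose_le:
  assumes fin: "finite S" and p: "p permutes S" and a: "a \<notin> S" and b: "b \<in> S"
  shows "card (cycles_on (Transposition.transpose a b \<circ> p) (insert a S)) \<le> card (cycles_on p S)"
proof -
  define q where "q = Transposition.transpose a b \<circ> p"
  have q: "q permutes insert a S"
    unfolding q_def using p b
    by (intro permutes_compose permutes_swap_id) (auto intro: permutes_subset)
  have fin': "finite (insert a S)" using fin by simp
  have self: "x \<in> orbit p x" for x
    by (rule permutation_self_in_orbit) (use p fin permutation_permutes in blast)
  have pa: "p a = a" by (rule permutes_not_in[OF p a])
  have qa: "q a = b" by (simp add: q_def pa)
  have jump: "p x = q x \<or> p x = q (q x)" if "x \<in> S" for x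
  proof (cases "p x = b")
    case True
    then have "q x = a" by (simp add: q_def)
    then show ?thesis using True qa by simp
  next
    case False
    moreover have "p x \<noteq> a" using that p a by (metis permutes_in_image)
    ultimately show ?thesis by (simp add: q_def Transposition.transpose_def)
  qed
  have forward: "q x \<in> orbit q x" "q (q x) \<in> orbit q x" for x
    by (auto intro: orbit.intros)
  have follow: "y \<in> orbit q x" if "x \<in> S" "y \<in> orbit p x" for x y
    using that(2)
  proof induction
    case base
    then show ?case using jump[OF that(1)] forward[of x] by auto
  next
    case (step y)
    have "y \<in> S" using permutes_orbit_subset[OF p that(1)] step.hyps by blast
    moreover have "q y \<in> orbit q x" "q (q y) \<in> orbit q x" using step.IH by (auto intro: orbit.step)
    ultimately show ?case using jump[of y] by auto
  qed
  have "orbit q a = orbit q b"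
    using orbit_mem_eq[OF fin' q, of b a] qa orbit.base[of q a] by simp
  then have "cycles_on q (insert a S) = orbit q ` S" using b by (auto simp: cycles_on_def)
  also have "card \<dots> \<le> card (orbit p ` S)"
  proof (rule card_image_le_of_factor[OF fin])
    fix x y assume xy: "x \<in> S" "y \<in> S" "orbit p x = orbit p y"
    then have "y \<in> orbit p x" using self by simp
    from orbit_mem_eq[OF fin' q follow[OF xy(1) this]] show "orbit q x = orbit q y" by simp
  qed
  finally show ?thesis by (simp add: q_def cycles_on_def)
qed

lemma card_cycles_insert_fixed_le:
  assumes "finite S"
  shows "card (cycles_on p (insert a S)) \<le> Suc (card (cycles_on p S))"
  using assms by (simp add: cycles_on_def card_insert_if)

text \<open>Each permutation of \<open>insert a S\<close> arises from one of \<open>S\<close> either by adding the fixed point \<open>a\<close>,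
  which creates a cycle, or by inserting \<open>a\<close> in front of one of the \<open>card S\<close> points, which does
  not. Dividing by the factorials, the mean number of cycles grows by at most \<open>1 / (card S + 1)\<close>.\<close>

lemma sum_card_cycles_le:
  assumes "finite S"
  shows "(\<Sum>p | p permutes S. real (card (cycles_on p S))) \<le> fact (card S) * harm (card S)"
  using assms
proof (induction S)
  case empty
  have "{p :: 'a \<Rightarrow> 'a. p permutes {}} = {id}" by auto
  then show ?case by (simp add: cycles_on_def harm_nonneg)
next
  case (insert a S)
  let ?P = "{p. p permutes S}"
  let ?F = "\<lambda>(b, p). Transposition.transpose a b \<circ> p"
  let ?c = "\<lambda>p. real (card (cycles_on p S))"
  let ?c' = "\<lambda>p. real (card (cycles_on p (insert a S)))"
  have finP: "finite ?P" by (rule finite_permutations[OF insert(1)])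
  have fin: "finite (insert a S \<times> ?P)" using finP insert(1) by simp
  have "{p. p permutes insert a S} = ?F ` (insert a S \<times> ?P)"
    unfolding permutes_insert by (rule arg_cong[of _ _ "image ?F"]) auto
  then have "(\<Sum>p | p permutes insert a S. ?c' p) = sum ?c' (?F ` (insert a S \<times> ?P))" by simp
  also have "\<dots> \<le> sum (?c' \<circ> ?F) (insert a S \<times> ?P)"
    by (rule sum_image_le[OF fin]) simp
  also have "\<dots> = (\<Sum>b\<in>insert a S. \<Sum>p\<in>?P. ?c' (Transposition.transpose a b \<circ> p))"
    by (simp add: sum.cartesian_product case_prod_beta)
  also have "\<dots> = (\<Sum>p\<in>?P. ?c' p) + (\<Sum>b\<in>S. \<Sum>p\<in>?P. ?c' (Transposition.transpose a b \<circ> p))"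
    using insert(1,2) by simp
  also have "\<dots> \<le> (\<Sum>p\<in>?P. ?c p + 1) + (\<Sum>b\<in>S. \<Sum>p\<in>?P. ?c p)"
  proof (intro add_mono sum_mono)
    fix p
    show "?c' p \<le> ?c p + 1" using card_cycles_insert_fixed_le[OF insert(1), of p a] by linarith
  next
    fix b p assume "b \<in> S" "p \<in> ?P"
    then show "?c' (Transposition.transpose a b \<circ> p) \<le> ?c p"
      using card_cycles_transpose_le[OF insert(1) _ insert(2)] by simp
  qed
  also have "\<dots> = real (Suc (card S)) * (\<Sum>p\<in>?P. ?c p) + fact (card S)"
    using card_permutations[OF refl insert(1)] by (simp add: sum.distrib algebra_simps)
  also have "\<dots> \<le> real (Suc (card S)) * (fact (card S) * harm (card S)) + fact (card S)"
    using insert.IH by (intro add_mono mult_left_mono) auto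
  also have "\<dots> = fact (Suc (card S)) * harm (Suc (card S))"
    by (simp add: harm_Suc field_simps)
  finally show ?case using insert(1,2) by simp
qed

lemma harm_le: "0 < n \<Longrightarrow> harm n \<le> 1 + ln (real n)"
proof -
  assume "0 < n"
  then obtain m where n: "n = Suc m" by (cases n) auto
  have "harm (Suc m) - ln (real (Suc m)) \<le> harm (Suc 0) - ln (real (Suc 0))"
    using decseq_harm_diff_ln by (rule decseqD[of "\<lambda>n. harm (Suc n) - ln (real (Suc n))"]) simp
  then show "harm n \<le> 1 + ln (real n)" by (simp add: n harm_Suc harm_expand(1))
qed

lemma pair_pmf_of_set:
  assumes "finite A" "A \<noteq> {}" "finite B" "B \<noteq> {}"
  shows "pair_pmf (pmf_of_set A) (pmf_of_set B) = pmf_of_set (A \<times> B)"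
proof (rule pmf_eqI)
  fix z :: "'a \<times> 'b"
  obtain x y where z: "z = (x, y)" by (cases z)
  show "pmf (pair_pmf (pmf_of_set A) (pmf_of_set B)) z = pmf (pmf_of_set (A \<times> B)) z"
    using assms by (simp add: z pmf_pair indicator_def card_cartesian_product)
qed

lemma cond_pmf_of_set:
  assumes "finite A" "A \<inter> B \<noteq> {}"
  shows "cond_pmf (pmf_of_set A) B = pmf_of_set (A \<inter> B)"
proof (rule pmf_eqI)
  fix x
  have ne: "A \<noteq> {}" using assms by auto
  have "set_pmf (pmf_of_set A) \<inter> B \<noteq> {}" using assms ne by simp
  then show "pmf (cond_pmf (pmf_of_set A) B) x = pmf (pmf_of_set (A \<inter> B)) x"
    using assms ne by (simp add: pmf_cond measure_pmf_of_set indicator_def card_gt_0_iff)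
qed

lemma
  assumes fin: "finite \<Omega>" and ne: "\<Omega> \<noteq> {}"
  shows random_transitive_pair_eq: "random_transitive_pair \<Omega> = pmf_of_set (transitive_pairs \<Omega>)"
    and finite_transitive_pairs: "finite (transitive_pairs \<Omega>)"
    and transitive_pairs_nonempty: "transitive_pairs \<Omega> \<noteq> {}"
proof -
  let ?P = "{\<pi>. \<pi> permutes \<Omega>}"
  have P: "finite ?P" "?P \<noteq> {}" using finite_permutations[OF fin] permutes_id[of \<Omega>] by blast+
  have eq: "transitive_pairs \<Omega> = (?P \<times> ?P) \<inter> {(\<sigma>0, \<sigma>1). generates_transitive \<Omega> \<sigma>0 \<sigma>1}"
    by (auto simp: transitive_pairs_def)
  show "finite (transitive_pairs \<Omega>)" unfolding eq using P by simp
  from ne obtain s where "s \<in> \<Omega>" by blast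
  then have "0 < card (transitive_pairs \<Omega>)"
    using card_transitive_pairs[OF fin] by (metis gr0I fact_nonzero le_zero_eq mult_0_right power_not_zero)
  then show ne': "transitive_pairs \<Omega> \<noteq> {}" by auto
  show "random_transitive_pair \<Omega> = pmf_of_set (transitive_pairs \<Omega>)"
    using P ne' unfolding eq random_transitive_pair_def random_perm_def
    by (simp add: pair_pmf_of_set cond_pmf_of_set)
qed

text \<open>The number of cycles is nonnegative, so its sum over the transitive pairs is at most the sum over
  all pairs, and the transitive ones make up at least half of all pairs.\<close>

lemma expected_cycles_le:
  assumes fin: "finite \<Omega>" and ne: "\<Omega> \<noteq> {}"
  shows "measure_pmf.expectation (random_transitive_pair \<Omega>)
           (\<lambda>(\<sigma>0, \<sigma>1). real (card (cycles_on \<sigma>0 \<Omega>))) \<le> 2 * harm (card \<Omega>)"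
proof -
  let ?T = "transitive_pairs \<Omega>" and ?P = "{\<pi>. \<pi> permutes \<Omega>}"
  let ?c = "\<lambda>\<sigma>. real (card (cycles_on \<sigma> \<Omega>))" and ?d = "card \<Omega>"
  note T = finite_transitive_pairs[OF fin ne] transitive_pairs_nonempty[OF fin ne]
  have P: "finite ?P" "card ?P = fact ?d"
    using finite_permutations[OF fin] card_permutations[OF refl fin] by auto
  from ne obtain s where "s \<in> \<Omega>" by blast
  from card_transitive_pairs[OF fin this] have "real ((fact ?d)\<^sup>2) \<le> real (2 * card ?T)"
    by (rule of_nat_mono)
  then have many: "(fact ?d)\<^sup>2 \<le> 2 * real (card ?T)" by simp
  have "(\<Sum>(\<sigma>0, \<sigma>1)\<in>?T. ?c \<sigma>0) \<le> (\<Sum>(\<sigma>0, \<sigma>1)\<in>?P \<times> ?P. ?c \<sigma>0)"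
    using P by (intro sum_mono2) (auto simp: transitive_pairs_def)
  also have "\<dots> = fact ?d * (\<Sum>\<sigma>\<in>?P. ?c \<sigma>)"
    by (simp add: sum.cartesian_product[symmetric] P sum_distrib_left)
  also have "\<dots> \<le> fact ?d * (fact ?d * harm ?d)"
    using sum_card_cycles_le[OF fin] by (intro mult_left_mono) auto
  also have "\<dots> = (fact ?d)\<^sup>2 * harm ?d" by (simp add: power2_eq_square)
  also have "\<dots> \<le> 2 * real (card ?T) * harm ?d"
    using many by (intro mult_right_mono) (auto simp: harm_nonneg)
  finally have "(\<Sum>(\<sigma>0, \<sigma>1)\<in>?T. ?c \<sigma>0) \<le> 2 * harm ?d * real (card ?T)" by (simp add: mult_ac)
  moreover have "0 < real (card ?T)" using T by (simp add: card_gt_0_iff)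
  ultimately show ?thesis
    unfolding random_transitive_pair_eq[OF fin ne] integral_pmf_of_set[OF T(2,1)]
    by (simp add: pos_divide_le_eq)
qed

lemma expectation_transitive_mono:
  assumes fin: "finite \<Omega>" and ne: "\<Omega> \<noteq> {}"
    and le: "\<And>\<sigma>0 \<sigma>1. \<sigma>0 permutes \<Omega> \<Longrightarrow> \<sigma>1 permutes \<Omega> \<Longrightarrow> generates_transitive \<Omega> \<sigma>0 \<sigma>1 \<Longrightarrow>
      f \<sigma>0 \<sigma>1 \<le> (h \<sigma>0 \<sigma>1 :: real)"
  shows "measure_pmf.expectation (random_transitive_pair \<Omega>) (\<lambda>(\<sigma>0, \<sigma>1). f \<sigma>0 \<sigma>1) \<le>
         measure_pmf.expectation (random_transitive_pair \<Omega>) (\<lambda>(\<sigma>0, \<sigma>1). h \<sigma>0 \<sigma>1)"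
proof -
  note T = finite_transitive_pairs[OF fin ne] transitive_pairs_nonempty[OF fin ne]
  show ?thesis
    unfolding random_transitive_pair_eq[OF fin ne] integral_pmf_of_set[OF T(2,1)]
    using le by (intro divide_right_mono sum_mono) (auto simp: transitive_pairs_def)
qed

lemma expectation_transitive_affine:
  assumes fin: "finite \<Omega>" and ne: "\<Omega> \<noteq> {}"
  shows "measure_pmf.expectation (random_transitive_pair \<Omega>) (\<lambda>(\<sigma>0, \<sigma>1). u + v * f \<sigma>0 \<sigma>1) =
    u + v * measure_pmf.expectation (random_transitive_pair \<Omega>) (\<lambda>(\<sigma>0, \<sigma>1). f \<sigma>0 \<sigma>1 :: real)"
proof -
  note T = finite_transitive_pairs[OF fin ne] transitive_pairs_nonempty[OF fin ne]
  have "0 < card (transitive_pairs \<Omega>)" using T by (simp add: card_gt_0_iff)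
  then show ?thesis
    unfolding random_transitive_pair_eq[OF fin ne] integral_pmf_of_set[OF T(2,1)]
    by (simp add: case_prod_beta sum.distrib sum_distrib_left[symmetric] field_simps)
qed

section \<open>Positivity of the Golomb-Dickman constant\<close>

text \<open>Positivity would fail if the integrand were not integrable, since the integral would then be 0 by
  convention. Both integrands are monotone on \<open>[0, 1)\<close>, and monotone functions are integrable. The
  logarithmic integral decreases because \<open>1 / ln u\<close> is negative on \<open>(0, 1)\<close>, so its exponential is at
  least \<open>exp (li (1/2))\<close> on the first half of the interval.\<close>

lemma golomb_dickman_pos: "0 < golomb_dickman"
proof -
  define li where "li = (\<lambda>t. integral {0..t} (\<lambda>u. 1 / ln u :: real))"
  (* At 1 the inner integral diverges and takes the default value 0, which breaks monotonicity;
     changing the integrand there does not affect its integral. *)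
  define F where "F = (\<lambda>t. if t = 1 then 0 else exp (li t))"
  have decreasing: "- (1 / ln u) \<le> - (1 / ln v)" if "0 \<le> u" "u \<le> v" "v < 1" for u v :: real
  proof (cases "u = 0")
    case True
    then show ?thesis using that by (cases "v = 0") (auto simp: divide_nonpos_neg)
  next
    case False
    then have "ln u \<le> ln v" "ln v < 0" using that by auto
    then show ?thesis by (simp add: divide_le_cancel frac_le_eq field_simps)
  qed
  have int: "(\<lambda>u. - (1 / ln u :: real)) integrable_on {0..t}" if "t < 1" for t
    by (rule integrable_on_mono_on) (use decreasing that in \<open>auto simp: mono_on_def\<close>)
  have li_antimono: "li t \<le> li s" if "0 \<le> s" "s \<le> t" "t < 1" for s t
  proof -
    have "integral {0..s} (\<lambda>u. - (1 / ln u :: real)) \<le> integral {0..t} (\<lambda>u. - (1 / ln u))"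
    proof (rule integral_subset_le)
      show "\<forall>u\<in>{0..t}. 0 \<le> - (1 / ln u)"
        using decreasing[of 0] that by auto
    qed (use that int in auto)
    then show ?thesis by (simp add: li_def)
  qed
  have "mono_on {0..1} (\<lambda>t. - F t)"
    using li_antimono by (auto simp: mono_on_def F_def)
  then have "(\<lambda>t. - F t) integrable_on {0..1}" by (rule integrable_on_mono_on)
  then have F_int: "F integrable_on {0..1}" by (simp add: integrable_neg_iff)
  have "golomb_dickman = integral {0..1} F"
    unfolding golomb_dickman_def by (rule integral_spike[of "{1}"]) (auto simp: F_def li_def)
  moreover have "F (1 / 2) / 2 \<le> integral {0..1} F"
  proof -
    have F_int': "F integrable_on {0..1 / 2}"
      by (rule integrable_subinterval_real[OF F_int]) auto
    have "F (1 / 2) / 2 = integral {0..1 / 2 :: real} (\<lambda>_. F (1 / 2))" by simp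
    also have "\<dots> \<le> integral {0..1 / 2} F"
      using F_int' li_antimono by (intro integral_le) (auto simp: F_def)
    also have "\<dots> \<le> integral {0..1} F"
      using F_int F_int' by (intro integral_subset_le) (auto simp: F_def)
    finally show ?thesis .
  qed
  moreover have "0 < F (1 / 2)" by (simp add: F_def)
  ultimately show ?thesis by simp
qed

section \<open>Expected costs\<close>

text \<open>The cost of a run is an affine function of the number \<open>r\<close> of cycles. Since \<open>n \<ge> 1\<close>, the integers are
  absorbed into the cost of the points, and since \<open>ln d \<ge> 1/2\<close>, so are the additive constants into the
  logarithm.\<close>

lemma expected_space_le:
  fixes g :: "complex vec \<Rightarrow> 'b::ab_group_add"
  assumes \<rho>: "0 < \<rho>R" "0 < \<rho>N" and \<Omega>: "finite \<Omega>" "2 \<le> card \<Omega>" "s1 \<in> \<Omega>"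
    and \<alpha>: "1 \<le> \<alpha>" and n: "1 \<le> n"
  shows "measure_pmf.expectation (random_transitive_pair \<Omega>)
           (\<lambda>(\<sigma>0, \<sigma>1). mc_space \<rho>R \<rho>N n \<sigma>0 \<sigma>1 g \<alpha> (card \<Omega>) s1)
         \<le> 34 * (\<rho>R + \<rho>N) *
             max (real n * (real (card \<Omega>) / real \<alpha>)) (real n * ln (real (card \<Omega>)))"
proof -
  let ?d = "card \<Omega>"
  let ?x = "real ?d / real \<alpha>"
  let ?r = "\<lambda>\<sigma>. real (card (cycles_on \<sigma> \<Omega>))"
  let ?E = "\<lambda>f. measure_pmf.expectation (random_transitive_pair \<Omega>) (\<lambda>(\<sigma>0, \<sigma>1). f \<sigma>0 \<sigma>1 :: real)"
  define c where "c = 2 * (\<rho>R + \<rho>N) * real n"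
  have ne: "\<Omega> \<noteq> {}" using \<Omega> by auto
  have c: "0 \<le> c" using \<rho> by (simp add: c_def)
  have "mc_space \<rho>R \<rho>N n \<sigma>0 \<sigma>1 g \<alpha> ?d s1 \<le> c * (?x + 5) + c * ?r \<sigma>0"
    if "\<sigma>0 permutes \<Omega>" "\<sigma>1 permutes \<Omega>" "generates_transitive \<Omega> \<sigma>0 \<sigma>1" for \<sigma>0 \<sigma>1
  proof -
    interpret monodromy_run \<Omega> \<sigma>0 \<sigma>1 s1 \<alpha> g
      using that \<Omega> \<alpha> by unfold_locales auto
    have "mc_space \<rho>R \<rho>N n \<sigma>0 \<sigma>1 g \<alpha> ?d s1 \<le>
        2 * real n * \<rho>R * (?x + ?r \<sigma>0 + 4) + \<rho>N * (2 * ?r \<sigma>0 + 10)"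
      using \<rho> by (intro space_bound) auto
    also have "\<dots> \<le> 2 * real n * \<rho>R * (?x + ?r \<sigma>0 + 5) + 2 * real n * \<rho>N * (?x + ?r \<sigma>0 + 5)"
    proof (intro add_mono mult_left_mono)
      have "\<rho>N * (2 * ?r \<sigma>0 + 10) = 1 * (2 * \<rho>N * (?r \<sigma>0 + 5))" by (simp add: algebra_simps)
      also have "\<dots> \<le> real n * (2 * \<rho>N * (?x + ?r \<sigma>0 + 5))"
        using n \<rho> by (intro mult_mono) auto
      finally show "\<rho>N * (2 * ?r \<sigma>0 + 10) \<le> 2 * real n * \<rho>N * (?x + ?r \<sigma>0 + 5)"
        by (simp add: mult_ac)
    qed (use \<rho> in auto)
    also have "\<dots> = c * (?x + 5) + c * ?r \<sigma>0" by (simp add: c_def algebra_simps)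
    finally show ?thesis .
  qed
  then have "?E (\<lambda>\<sigma>0 \<sigma>1. mc_space \<rho>R \<rho>N n \<sigma>0 \<sigma>1 g \<alpha> ?d s1) \<le> ?E (\<lambda>\<sigma>0 \<sigma>1. c * (?x + 5) + c * ?r \<sigma>0)"
    by (rule expectation_transitive_mono[OF \<Omega>(1) ne])
  also have "\<dots> = c * (?x + 5) + c * ?E (\<lambda>\<sigma>0 \<sigma>1. ?r \<sigma>0)"
    by (rule expectation_transitive_affine[OF \<Omega>(1) ne])
  also have "\<dots> \<le> c * (?x + 5) + c * (2 * harm ?d)"
    using expected_cycles_le[OF \<Omega>(1) ne] c by (intro add_left_mono mult_left_mono)
  also have "\<dots> = c * (?x + 5 + 2 * harm ?d)" by (simp add: algebra_simps)
  (* 5 + 2 * harm d <= 7 + 2 * ln d, and 7 <= 14 * ln d because 1/2 <= ln 2 <= ln d. *)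
  also have "\<dots> \<le> c * (?x + 16 * ln (real ?d))"
  proof (rule mult_left_mono[OF _ c])
    have "1 / 2 \<le> ln (2 :: real)" using ln_le_minus_one[of "1 / 2 :: real"] by (simp add: ln_div)
    also have "ln 2 \<le> ln (real ?d)" using \<Omega>(2) by (simp add: ln_le_cancel_iff)
    finally show "?x + 5 + 2 * harm ?d \<le> ?x + 16 * ln (real ?d)"
      using harm_le[of ?d] \<Omega>(2) by simp
  qed
  also have "\<dots> = 2 * (\<rho>R + \<rho>N) * (real n * ?x + 16 * (real n * ln (real ?d)))"
    by (simp add: c_def algebra_simps)
  also have "\<dots> \<le> 2 * (\<rho>R + \<rho>N) * (17 * max (real n * ?x) (real n * ln (real ?d)))"
  proof (rule mult_left_mono)
    have "u + 16 * v \<le> 17 * max u v" for u v :: real by (simp add: max_def)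
    then show "real n * ?x + 16 * (real n * ln (real ?d)) \<le>
        17 * max (real n * ?x) (real n * ln (real ?d))" .
  qed (use \<rho> in simp)
  also have "\<dots> = 34 * (\<rho>R + \<rho>N) * max (real n * ?x) (real n * ln (real ?d))"
    by (simp add: algebra_simps)
  finally show ?thesis .
qed

text \<open>Here \<open>\<kappa>\<close> may be any positive constant, as \<open>min \<kappa> 1 * min d \<alpha> \<le> min (\<kappa> d) \<alpha>\<close>.\<close>

lemma expected_time_le:
  fixes g :: "complex vec \<Rightarrow> 'b::ab_group_add"
  assumes \<Omega>: "finite \<Omega>" "s1 \<in> \<Omega>" and \<alpha>: "1 \<le> \<alpha>" and \<kappa>: "0 < \<kappa>"
  shows "measure_pmf.expectation (random_transitive_pair \<Omega>)
           (\<lambda>(\<sigma>0, \<sigma>1). real (mc_time \<sigma>0 \<sigma>1 g \<alpha> (card \<Omega>) s1))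
         \<le> 3 / min \<kappa> 1 * (real (card \<Omega>) * min (\<kappa> * real (card \<Omega>)) (real \<alpha>))"
proof -
  let ?d = "card \<Omega>"
  let ?E = "\<lambda>f. measure_pmf.expectation (random_transitive_pair \<Omega>) (\<lambda>(\<sigma>0, \<sigma>1). f \<sigma>0 \<sigma>1 :: real)"
  have ne: "\<Omega> \<noteq> {}" using \<Omega> by auto
  let ?b = "real (3 * ?d * min ?d \<alpha>)"
  have "real (mc_time \<sigma>0 \<sigma>1 g \<alpha> ?d s1) \<le> ?b"
    if "\<sigma>0 permutes \<Omega>" "\<sigma>1 permutes \<Omega>" "generates_transitive \<Omega> \<sigma>0 \<sigma>1" for \<sigma>0 \<sigma>1
  proof -
    interpret monodromy_run \<Omega> \<sigma>0 \<sigma>1 s1 \<alpha> g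
      using that \<Omega> \<alpha> by unfold_locales auto
    show ?thesis using of_nat_mono[OF time_bound, where 'a = real] by simp
  qed
  then have "?E (\<lambda>\<sigma>0 \<sigma>1. real (mc_time \<sigma>0 \<sigma>1 g \<alpha> ?d s1)) \<le> ?E (\<lambda>\<sigma>0 \<sigma>1. ?b)"
    by (rule expectation_transitive_mono[OF \<Omega>(1) ne])
  also have "\<dots> = 3 * real ?d * min (real ?d) (real \<alpha>)" by (simp add: case_prod_unfold of_nat_min)
  also have "\<dots> \<le> 3 * real ?d * (min (\<kappa> * real ?d) (real \<alpha>) / min \<kappa> 1)"
  proof (intro mult_left_mono)
    have "min \<kappa> 1 * min (real ?d) (real \<alpha>) \<le> \<kappa> * real ?d"
      using \<kappa> by (intro mult_mono) auto
    moreover have "min \<kappa> 1 * min (real ?d) (real \<alpha>) \<le> 1 * real \<alpha>"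
      using \<kappa> by (intro mult_mono) auto
    ultimately have "min \<kappa> 1 * min (real ?d) (real \<alpha>) \<le> min (\<kappa> * real ?d) (real \<alpha>)" by simp
    then show "min (real ?d) (real \<alpha>) \<le> min (\<kappa> * real ?d) (real \<alpha>) / min \<kappa> 1"
      using \<kappa> by (simp add: pos_le_divide_eq mult.commute)
  qed auto
  finally show ?thesis by (simp add: mult_ac)
qed

theorem theorem2:
  shows "\<exists>(K::nat) (Ct::real). \<forall>\<rho>R > 0. \<forall>\<rho>N > 0. \<exists>Cs::real.
    \<forall>(n::nat) (d::nat) (\<Omega>::complex vec set) s1 (\<alpha>::nat) (g::complex vec \<Rightarrow> 'b::ab_group_add).
      \<Omega> \<subseteq> carrier_vec n \<and> card \<Omega> = d \<and> 2 \<le> d \<and> s1 \<in> \<Omega> \<and> 1 \<le> \<alpha> \<longrightarrow>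
      (\<forall>\<sigma>0 \<sigma>1. \<sigma>0 permutes \<Omega> \<and> \<sigma>1 permutes \<Omega> \<and> generates_transitive \<Omega> \<sigma>0 \<sigma>1 \<longrightarrow>
         (\<exists>st. mc_run \<sigma>0 \<sigma>1 g \<alpha> d s1 = Some st \<and>
            accum st = (\<Sum>s\<in>\<Omega>. g s) \<and>
            queries st \<le> d - 1 + largest_founder \<sigma>0 \<sigma>1 d s1 *
                             (min (Max (card ` cycles_on \<sigma>0 \<Omega>)) \<alpha> + 1)) \<and>
         (\<forall>st \<in> mc_visited \<sigma>0 \<sigma>1 g \<alpha> d s1.
            stored_points st \<le> (\<Sum>c\<in>cycles_on \<sigma>0 \<Omega>. nat \<lceil>real (card c) / real \<alpha>\<rceil>) + K \<and>
            stored_ints st \<le> 2 * card (cycles_on \<sigma>0 \<Omega>) - 1 + K \<and>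
            (\<forall>i \<in> set (mc_ints st). i \<le> d))) \<and>
      measure_pmf.expectation (random_transitive_pair \<Omega>)
        (\<lambda>(\<sigma>0, \<sigma>1). mc_space \<rho>R \<rho>N n \<sigma>0 \<sigma>1 g \<alpha> d s1)
        \<le> Cs * max (real n * (real d / real \<alpha>)) (real n * ln (real d)) \<and>
      measure_pmf.expectation (random_transitive_pair \<Omega>)
        (\<lambda>(\<sigma>0, \<sigma>1). real (mc_time \<sigma>0 \<sigma>1 g \<alpha> d s1))
        \<le> Ct * (real d * min (golomb_dickman * real d) (real \<alpha>))"
(* Outside the lists, 4 points and 10 integers are counted. *)
proof (rule exI[of _ 10], rule exI[of _ "3 / min golomb_dickman 1"], intro allI impI, goal_cases)
  case (1 \<rho>R \<rho>N)
  note \<rho> = this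
  show ?case
  proof (rule exI[of _ "34 * (\<rho>R + \<rho>N)"], intro allI impI conjI ballI)
    fix n d :: nat and \<Omega> :: "complex vec set" and s1 and \<alpha> :: nat and g :: "complex vec \<Rightarrow> 'b"
    assume "\<Omega> \<subseteq> carrier_vec n \<and> card \<Omega> = d \<and> 2 \<le> d \<and> s1 \<in> \<Omega> \<and> 1 \<le> \<alpha>"
    then have h: "\<Omega> \<subseteq> carrier_vec n" "2 \<le> card \<Omega>" "s1 \<in> \<Omega>" "1 \<le> \<alpha>" and d: "d = card \<Omega>"
      by auto
    have fin: "finite \<Omega>" using h(2) by (metis card.infinite not_numeral_le_zero)
    (* The space of dimension 0 is a single point, so it cannot hold two solutions. *)
    have n: "1 \<le> n"
    proof (rule ccontr)
      assume "\<not> 1 \<le> n"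
      then have "dim_vec x = 0 \<Longrightarrow> x = vNil" "n = 0" for x :: "complex vec" by simp_all
      moreover have "dim_vec x = n" if "x \<in> \<Omega>" for x
        using that h(1) by (metis carrier_vecD subsetD)
      ultimately have "x = vNil" if "x \<in> \<Omega>" for x using that by metis
      then have "\<Omega> \<subseteq> {vNil}" by blast
      then have "card \<Omega> \<le> card {vNil :: complex vec}" by (intro card_mono) auto
      then show False using h(2) by simp
    qed
    show "measure_pmf.expectation (random_transitive_pair \<Omega>)
        (\<lambda>(\<sigma>0, \<sigma>1). mc_space \<rho>R \<rho>N n \<sigma>0 \<sigma>1 g \<alpha> d s1)
        \<le> 34 * (\<rho>R + \<rho>N) * max (real n * (real d / real \<alpha>)) (real n * ln (real d))"
      unfolding d by (rule expected_space_le[OF \<rho> fin h(2-4) n])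
    show "measure_pmf.expectation (random_transitive_pair \<Omega>)
        (\<lambda>(\<sigma>0, \<sigma>1). real (mc_time \<sigma>0 \<sigma>1 g \<alpha> d s1))
        \<le> 3 / min golomb_dickman 1 * (real d * min (golomb_dickman * real d) (real \<alpha>))"
      unfolding d by (rule expected_time_le[OF fin h(3,4) golomb_dickman_pos])
    fix \<sigma>0 \<sigma>1
    assume "\<sigma>0 permutes \<Omega> \<and> \<sigma>1 permutes \<Omega> \<and> generates_transitive \<Omega> \<sigma>0 \<sigma>1"
    then interpret monodromy_run \<Omega> \<sigma>0 \<sigma>1 s1 \<alpha> g
      using fin h by unfold_locales auto
    show "\<exists>st. mc_run \<sigma>0 \<sigma>1 g \<alpha> d s1 = Some st \<and> accum st = (\<Sum>s\<in>\<Omega>. g s) \<and>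
          queries st \<le> d - 1 + largest_founder \<sigma>0 \<sigma>1 d s1 *
                           (min (Max (card ` cycles_on \<sigma>0 \<Omega>)) \<alpha> + 1)"
      using terminates result(1,2) unfolding d probe_bound_def by blast
    fix st assume "st \<in> mc_visited \<sigma>0 \<sigma>1 g \<alpha> d s1"
    then have inv: "invariant st" unfolding d by (rule visited_invariant)
    show "stored_points st \<le> (\<Sum>c\<in>cycles_on \<sigma>0 \<Omega>. nat \<lceil>real (card c) / real \<alpha>\<rceil>) + 10"
      using points_bound[OF inv] by linarith
    show "stored_ints st \<le> 2 * card (cycles_on \<sigma>0 \<Omega>) - 1 + 10"
      by (rule ints_bound(1)[OF inv])
    fix i assume "i \<in> set (mc_ints st)"
    then show "i \<le> d" using ints_bound(2)[OF inv] by (simp add: d)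
  qed
qed

end
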